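(* Let $V\in C^\infty(\mathbb T)$, $\mathbb T=\mathbb R/\mathbb Z$, satisfy $V\le0$, $V^{-1}(0)=\{0,\frac12\}$, $V''(0)<0$, $V''(\frac12)<0$. Set $Q(x)=\sqrt{-2V(x)}$, $A=\int_0^{1/2}Q(s)\,\mathrm{d}s$, $B=\int_{1/2}^1Q(s)\,\mathrm{d}s$, assume $A<B$, and put $a=\frac{3A+B}{2}$. For the Hamiltonian $H_a(x,p)=\frac12(p+a)^2+V(x)$, let $u_\lambda$ ($\lambda>0$) be the viscosity solution of $\lambda u_\lambda+\frac12(u_\lambda'+a)^2+V(x)=0$ in $\mathbb T$ and let $u_0=\lim_{\lambda\to0^+}u_\lambda$. Then there exist $C_0>0$ and $\lambda_0>0$ such that $$\|u_\lambda-u_0\|_\infty\ge C_0\lambda|\log\lambda|\qquad\text{for }0<\lambda\le\lambda_0.$$ Consequently, $\|u_\lambda-u_0\|_\infty\asymp\lambda|\log\lambda|$ as $\lambda\to0^+$.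
   Context: The critical value of $H_a$ (the unique $c$ for which $H_a(x,u')=c$ has a viscosity solution on $\mathbb T$) is $0$, so the equation is the discounted equation $\lambda u_\lambda+H_a(x,u_\lambda')=c(H_a)$. It is known that $u_\lambda$ converges uniformly as $\lambda\to0^+$; $u_0$ denotes the limit. The notation $f(\lambda)\asymp g(\lambda)$ means that $C^{-1}g(\lambda)\le f(\lambda)\le Cg(\lambda)$ for some constant $C\ge1$ independent of $\lambda$ and all sufficiently small $\lambda>0$. *)

theory Defs
  imports "HOL-Analysis.Analysis" "HOL-Library.Periodic_Fun"
begin

text \<open>
  A function on the torus \<open>\<real>/\<int>\<close> is represented by its lift, a function on \<^typ>\<open>real\<close> satisfying
  \<^const>\<open>periodic_fun_simple'\<close> (period one).
\<close>

definition smooth :: "(real \<Rightarrow> real) \<Rightarrow> bool" where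
  "smooth f \<longleftrightarrow> (\<forall>k x. (deriv ^^ k) f field_differentiable (at x))"

text \<open>
  Viscosity sub- and supersolutions of the first-order equation \<open>F x (u x) (u' x) = 0\<close>. The maxima
  and minima of \<open>u - \<phi>\<close> are local, so testing the lift with \<open>C\<^sup>1\<close> functions on the line amounts to
  testing with \<open>C\<^sup>1\<close> functions on the torus.
\<close>

definition viscosity_subsolution ::
    "(real \<Rightarrow> real \<Rightarrow> real \<Rightarrow> real) \<Rightarrow> (real \<Rightarrow> real) \<Rightarrow> bool" where
  "viscosity_subsolution F u \<longleftrightarrow>
     (\<forall>\<phi> x. \<phi> C1_differentiable_on UNIV \<longrightarrow>
        (\<forall>\<^sub>F y in nhds x. u y - \<phi> y \<le> u x - \<phi> x) \<longrightarrow> F x (u x) (deriv \<phi> x) \<le> 0)"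

definition viscosity_supersolution ::
    "(real \<Rightarrow> real \<Rightarrow> real \<Rightarrow> real) \<Rightarrow> (real \<Rightarrow> real) \<Rightarrow> bool" where
  "viscosity_supersolution F u \<longleftrightarrow>
     (\<forall>\<phi> x. \<phi> C1_differentiable_on UNIV \<longrightarrow>
        (\<forall>\<^sub>F y in nhds x. u y - \<phi> y \<ge> u x - \<phi> x) \<longrightarrow> F x (u x) (deriv \<phi> x) \<ge> 0)"

definition torus_viscosity_solution ::
    "(real \<Rightarrow> real \<Rightarrow> real \<Rightarrow> real) \<Rightarrow> (real \<Rightarrow> real) \<Rightarrow> bool" where
  "torus_viscosity_solution F u \<longleftrightarrow>
     periodic_fun_simple' u \<and> continuous_on UNIV u \<and>
     viscosity_subsolution F u \<and> viscosity_supersolution F u"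

definition hamiltonian :: "(real \<Rightarrow> real) \<Rightarrow> real \<Rightarrow> real \<Rightarrow> real \<Rightarrow> real" where
  "hamiltonian V a x p = (p + a)\<^sup>2 / 2 + V x"

text \<open>By periodicity, the supremum over the line is the supremum over the torus.\<close>

definition sup_norm :: "(real \<Rightarrow> real) \<Rightarrow> real" where
  "sup_norm f = (SUP x. \<bar>f x\<bar>)"

definition asymp_0 :: "(real \<Rightarrow> real) \<Rightarrow> (real \<Rightarrow> real) \<Rightarrow> bool" where
  "asymp_0 f g \<longleftrightarrow>
     (\<exists>C\<ge>1. \<forall>\<^sub>F l in at_right 0. inverse C * g l \<le> f l \<and> f l \<le> C * g l)"

end

theory Submission
  imports Defs
begin

text \<open>
  Put \<open>w = u\<^sub>\<lambda> + a x\<close> and \<open>g = sqrt (Q\<^sup>2 - 2 \<lambda> u\<^sub>\<lambda>)\<close>, so that \<open>w\<close> solves the eikonal equation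
  \<open>\<bar>w'\<bar> = g\<close>. Where \<open>g > 0\<close> the function \<open>w\<close> has no local minimum, so it first increases and then
  decreases, with slopes \<open>g\<close> and \<open>-g\<close>. Since \<open>g > 0\<close> on \<open>[C\<lambda>, 1 - C\<lambda>]\<close>, and since \<open>u\<^sub>\<lambda> 0 = O(\<lambda>)\<close>
  (otherwise \<open>g > 0\<close> everywhere and \<open>w\<close> would be monotone, gaining about \<open>A + B > a\<close> per period),
  on \<open>[0, 1]\<close> the function \<open>w\<close> equals \<open>min (\<integral>\<^sub>0\<^sup>x g) (a + \<integral>\<^sub>x\<^sup>1 g)\<close> up to \<open>O(\<lambda>)\<close>; the limit is the same
  expression with \<open>Q\<close> instead of \<open>g\<close>. As \<open>\<bar>g - Q\<bar> = O(\<lambda> / (d + sqrt \<lambda>))\<close> at distance \<open>d\<close> from the zeros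
  of \<open>V\<close>, the error is at most of order \<open>\<lambda> \<bar>log \<lambda>\<bar>\<close>. This order is attained at \<open>1/2\<close>: there \<open>u\<^sub>0\<close> is
  \<open>(A - B)/4 < 0\<close>, hence \<open>g - Q\<close> is bounded below by a multiple of \<open>\<lambda> / (d + sqrt \<lambda>)\<close>, whereas near
  \<open>0\<close> it is bounded below by \<open>- O(\<lambda>)\<close>.
\<close>

section \<open>Eikonal equations on the line\<close>

text \<open>Viscosity inequality for \<open>\<bar>w'\<bar>\<^sup>2 = G\<close>. The derivative of
  the test function is a separate argument, so that test functions can be built with derivative
  rules instead of through \<open>deriv\<close>.\<close>

definition eikonal_sub :: "(real \<Rightarrow> real) \<Rightarrow> (real \<Rightarrow> real) \<Rightarrow> bool" where
  "eikonal_sub G w \<longleftrightarrow>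
     (\<forall>\<phi> \<phi>' x. (\<forall>t. (\<phi> has_real_derivative \<phi>' t) (at t)) \<longrightarrow> continuous_on UNIV \<phi>' \<longrightarrow>
        (\<forall>\<^sub>F y in nhds x. w y - \<phi> y \<le> w x - \<phi> x) \<longrightarrow> (\<phi>' x)\<^sup>2 \<le> G x)"

definition eikonal_super :: "(real \<Rightarrow> real) \<Rightarrow> (real \<Rightarrow> real) \<Rightarrow> bool" where
  "eikonal_super G w \<longleftrightarrow>
     (\<forall>\<phi> \<phi>' x. (\<forall>t. (\<phi> has_real_derivative \<phi>' t) (at t)) \<longrightarrow> continuous_on UNIV \<phi>' \<longrightarrow>
        (\<forall>\<^sub>F y in nhds x. w y - \<phi> y \<ge> w x - \<phi> x) \<longrightarrow> (\<phi>' x)\<^sup>2 \<ge> G x)"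

lemma DERIV_imp_continuous_on:
  fixes f :: "real \<Rightarrow> real"
  assumes "\<And>t. (f has_real_derivative f' t) (at t)"
  shows "continuous_on S f"
  by (rule DERIV_continuous_on[OF has_field_derivative_at_within[OF assms]])

lemma eikonal_subD:
  assumes "eikonal_sub G w" "\<And>t. (\<phi> has_real_derivative \<phi>' t) (at t)" "continuous_on UNIV \<phi>'"
    and "\<forall>\<^sub>F y in nhds x. w y - \<phi> y \<le> w x - \<phi> x"
  shows "(\<phi>' x)\<^sup>2 \<le> G x"
  using assms unfolding eikonal_sub_def by (elim allE[of _ \<phi>] allE[of _ \<phi>'] allE[of _ x]) simp

lemma eikonal_superD:
  assumes "eikonal_super G w" "\<And>t. (\<phi> has_real_derivative \<phi>' t) (at t)" "continuous_on UNIV \<phi>'"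
    and "\<forall>\<^sub>F y in nhds x. w y - \<phi> y \<ge> w x - \<phi> x"
  shows "(\<phi>' x)\<^sup>2 \<ge> G x"
  using assms unfolding eikonal_super_def by (elim allE[of _ \<phi>] allE[of _ \<phi>'] allE[of _ x]) simp

section \<open>Reflection of the line\<close>

lemma continuous_on_reflect:
  fixes f :: "real \<Rightarrow> real"
  assumes "continuous_on UNIV f"
  shows "continuous_on UNIV (\<lambda>t. f (- t))"
  by (rule continuous_on_compose2[OF assms]) (auto intro: continuous_on_minus continuous_on_id)

lemma eventually_nhds_minus:
  fixes x :: real
  assumes "\<forall>\<^sub>F y in nhds x. P (- y)"
  shows "\<forall>\<^sub>F y in nhds (- x). P y"
proof -
  have "filtermap uminus (nhds x) = nhds (- x)"
    by (rule filtermap_nhds_minus)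
  with assms show ?thesis
    by (metis eventually_filtermap)
qed

text \<open>The equation only sees the square of the slope, so reversing the line preserves it.
  Estimates for increasing \<open>x\<close> thereby transfer to decreasing \<open>x\<close>.\<close>

lemma eikonal_sub_reflect:
  assumes "eikonal_sub G w"
  shows "eikonal_sub (\<lambda>x. G (- x)) (\<lambda>x. w (- x))"
  unfolding eikonal_sub_def
proof (intro allI impI)
  fix \<phi> \<phi>' :: "real \<Rightarrow> real" and x
  assume d: "\<forall>t. (\<phi> has_real_derivative \<phi>' t) (at t)" and c: "continuous_on UNIV \<phi>'"
    and e: "\<forall>\<^sub>F y in nhds x. w (- y) - \<phi> y \<le> w (- x) - \<phi> x"
  have "\<forall>t. ((\<lambda>t. \<phi> (- t)) has_real_derivative - \<phi>' (- t)) (at t)"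
    using d by (simp flip: DERIV_mirror)
  moreover have "continuous_on UNIV (\<lambda>t. - \<phi>' (- t))"
    using c by (auto intro!: continuous_intros continuous_on_compose2[OF c])
  moreover have "\<forall>\<^sub>F y in nhds (- x). w y - \<phi> (- y) \<le> w (- x) - \<phi> (- (- x))"
    by (rule eventually_nhds_minus) (use e in simp)
  ultimately have "(- \<phi>' (- (- x)))\<^sup>2 \<le> G (- x)"
    using eikonal_subD[OF assms, of "\<lambda>t. \<phi> (- t)" "\<lambda>t. - \<phi>' (- t)" "- x"] by simp
  then show "(\<phi>' x)\<^sup>2 \<le> G (- x)"
    by simp
qed

lemma eikonal_super_reflect:
  assumes "eikonal_super G w"
  shows "eikonal_super (\<lambda>x. G (- x)) (\<lambda>x. w (- x))"
  unfolding eikonal_super_def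
proof (intro allI impI)
  fix \<phi> \<phi>' :: "real \<Rightarrow> real" and x
  assume d: "\<forall>t. (\<phi> has_real_derivative \<phi>' t) (at t)" and c: "continuous_on UNIV \<phi>'"
    and e: "\<forall>\<^sub>F y in nhds x. w (- y) - \<phi> y \<ge> w (- x) - \<phi> x"
  have "\<forall>t. ((\<lambda>t. \<phi> (- t)) has_real_derivative - \<phi>' (- t)) (at t)"
    using d by (simp flip: DERIV_mirror)
  moreover have "continuous_on UNIV (\<lambda>t. - \<phi>' (- t))"
    using c by (auto intro!: continuous_intros continuous_on_compose2[OF c])
  moreover have "\<forall>\<^sub>F y in nhds (- x). w y - \<phi> (- y) \<ge> w (- x) - \<phi> (- (- x))"
    by (rule eventually_nhds_minus) (use e in simp)
  ultimately have "(- \<phi>' (- (- x)))\<^sup>2 \<ge> G (- x)"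
    using eikonal_superD[OF assms, of "\<lambda>t. \<phi> (- t)" "\<lambda>t. - \<phi>' (- t)" "- x"] by simp
  then show "(\<phi>' x)\<^sup>2 \<ge> G (- x)"
    by simp
qed

section \<open>Touching points and comparison with a primitive\<close>

lemma interior_local_max:
  fixes f :: "real \<Rightarrow> real"
  assumes "continuous_on {p..q} f" and r: "p < r" "r < q" and "f p \<le> f r" "f q \<le> f r"
  obtains x where "p < x" "x < q" "\<forall>\<^sub>F y in nhds x. f y \<le> f x"
proof -
  obtain m where m: "m \<in> {p..q}" "\<forall>y\<in>{p..q}. f y \<le> f m"
    using continuous_attains_sup[of "{p..q}" f] assms by auto
  \<comment> \<open>If the maximum sits at an endpoint, the value at \<open>r\<close> is no smaller,
    so \<open>r\<close> is an interior maximum point as well.\<close>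
  define x where "x = (if m = p \<or> m = q then r else m)"
  have x: "p < x" "x < q" and max: "\<forall>y\<in>{p..q}. f y \<le> f x"
    using m assms by (auto simp: x_def intro: order_trans)
  have "\<forall>\<^sub>F y in nhds x. y \<in> {p<..<q}"
    using x by (intro eventually_nhds_in_open) auto
  then have "\<forall>\<^sub>F y in nhds x. f y \<le> f x"
    by eventually_elim (use max in auto)
  with x that show thesis by blast
qed

lemma interior_local_min:
  fixes f :: "real \<Rightarrow> real"
  assumes "continuous_on {p..q} f" and "p < r" "r < q" and "f p \<ge> f r" "f q \<ge> f r"
  obtains x where "p < x" "x < q" "\<forall>\<^sub>F y in nhds x. f y \<ge> f x"
  using interior_local_max[of p q "\<lambda>x. - f x" r] assms
  by (auto intro: continuous_intros)

text \<open>This is the penalty used below: it vanishes up to \<open>z\<close>, grows afterwards,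
  and is still continuously differentiable at \<open>z\<close>.\<close>

lemma DERIV_pos_part_square:
  fixes z t :: real
  shows "((\<lambda>t. (max 0 (t - z))\<^sup>2) has_real_derivative 2 * max 0 (t - z)) (at t)"
proof -
  consider "t < z" | "t = z" | "t > z" by linarith
  then show ?thesis
  proof cases
    case 1
    have "((\<lambda>t. 0::real) has_real_derivative 0) (at t)" by simp
    then have "((\<lambda>t. (max 0 (t - z))\<^sup>2) has_real_derivative 0) (at t)"
      by (rule has_field_derivative_transform_within_open[where S="{..<z}"]) (use 1 in auto)
    with 1 show ?thesis by simp
  next
    case 2
    have "((\<lambda>h::real. max 0 h) \<longlongrightarrow> max 0 0) (at 0)"
      by (intro tendsto_intros)
    moreover have "\<forall>\<^sub>F h::real in at 0. max 0 h = ((max 0 (t + h - z))\<^sup>2 - (max 0 (t - z))\<^sup>2) / h"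
      using 2 by (auto simp: eventually_at_filter power2_eq_square max_def)
    ultimately have "((\<lambda>h. ((max 0 (t + h - z))\<^sup>2 - (max 0 (t - z))\<^sup>2) / h) \<longlongrightarrow> 0) (at 0)"
      by (auto intro: Lim_transform_eventually)
    with 2 show ?thesis by (simp add: DERIV_def)
  next
    case 3
    have "((\<lambda>t. (t - z)\<^sup>2) has_real_derivative 2 * (t - z)) (at t)"
      by (auto intro!: derivative_eq_intros)
    then have "((\<lambda>t. (max 0 (t - z))\<^sup>2) has_real_derivative 2 * (t - z)) (at t)"
      by (rule has_field_derivative_transform_within_open[where S="{z<..}"]) (use 3 in auto)
    with 3 show ?thesis by simp
  qed
qed

text \<open>A steep enough parabola touches \<open>w\<close> from above at some point of any given
  ball, and the squared slope there is at most \<open>G\<close>.\<close>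

lemma eikonal_sub_nonneg:
  assumes sub: "eikonal_sub G w" and w: "continuous_on UNIV w" and G: "continuous_on UNIV G"
  shows "0 \<le> G x"
proof (rule ccontr)
  assume "\<not> 0 \<le> G x"
  then have "open {t. G t < 0}" "x \<in> {t. G t < 0}"
    using G by (auto intro!: open_Collect_less continuous_intros)
  then obtain d where d: "d > 0" "cball x d \<subseteq> {t. G t < 0}"
    by (meson open_contains_cball)
  \<comment> \<open>Large enough that \<open>K * d\<^sup>2\<close> dominates the rise of
    \<open>w\<close> from \<open>x\<close> to either end, which gives an interior maximum.\<close>
  define K where "K = (\<bar>w (x + d) - w x\<bar> + \<bar>w (x - d) - w x\<bar>) / d\<^sup>2"
  have Kd: "K * d\<^sup>2 = \<bar>w (x + d) - w x\<bar> + \<bar>w (x - d) - w x\<bar>"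
    using d by (simp add: K_def)
  have "continuous_on {x-d..x+d} (\<lambda>t. w t - K * (t - x)\<^sup>2)"
    by (intro continuous_intros continuous_on_subset[OF w]) auto
  then obtain y where y: "x - d < y" "y < x + d"
      "\<forall>\<^sub>F t in nhds y. w t - K * (t - x)\<^sup>2 \<le> w y - K * (y - x)\<^sup>2"
    by (rule interior_local_max[where r=x]) (use d Kd in auto)
  have "(2 * K * (y - x))\<^sup>2 \<le> G y"
  proof -
    have "\<forall>t. ((\<lambda>t. K * (t - x)\<^sup>2) has_real_derivative 2 * K * (t - x)) (at t)"
      by (auto intro!: derivative_eq_intros)
    moreover have "continuous_on UNIV (\<lambda>t. 2 * K * (t - x))"
      by (intro continuous_intros)
    ultimately show ?thesis
      using eikonal_subD[OF sub _ _ y(3), of "\<lambda>t. 2 * K * (t - x)"] by blast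
  qed
  moreover have "y \<in> cball x d"
    using y by (simp add: dist_real_def)
  then have "G y < 0"
    using d by blast
  ultimately show False
    by (smt (verit) zero_le_power2)
qed

text \<open>A test function with slope above \<open>g\<close> cannot touch \<open>w\<close> from
  above. If \<open>w\<close> gained more than \<open>W\<close>, then \<open>W\<close> plus a small
  linear term plus a penalty beyond \<open>z\<close> would be such a function.\<close>

lemma eikonal_sub_increment:
  assumes sub: "eikonal_sub (\<lambda>t. (g t)\<^sup>2) w" and w: "continuous_on UNIV w"
    and g: "continuous_on UNIV g" "\<And>t. g t \<ge> 0"
    and W: "\<And>t. (W has_real_derivative g t) (at t)" and "x \<le> z"
  shows "w z - w x \<le> W z - W x"
proof (rule ccontr)
  assume c: "\<not> w z - w x \<le> W z - W x"
  with \<open>x \<le> z\<close> have xz: "x < z" by (cases "x = z") auto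
  \<comment> \<open>The excess of the mean slope: \<open>w t - W t - e * t\<close> takes equal
    values at \<open>x\<close> and \<open>z\<close>.\<close>
  define e where "e = (w z - w x - (W z - W x)) / (z - x)"
  have e: "e > 0" "e * (z - x) = w z - w x - (W z - W x)"
    using c xz by (auto simp: e_def)
  \<comment> \<open>The penalty equals \<open>K\<close> at \<open>z + 1\<close>, which keeps the
    difference there at or below its value at \<open>z\<close>, so \<open>z\<close> can play the
    role of the interior point.\<close>
  define K where "K = \<bar>w (z + 1) - w z\<bar>"
  define \<phi> where "\<phi> = (\<lambda>t. W t + e * t + K * (max 0 (t - z))\<^sup>2)"
  have d: "\<forall>t. (\<phi> has_real_derivative g t + e + K * (2 * max 0 (t - z))) (at t)"
    unfolding \<phi>_def
    by (auto intro!: DERIV_add DERIV_cmult W DERIV_pos_part_square DERIV_cmult_Id)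
  have cd: "continuous_on UNIV (\<lambda>t. g t + e + K * (2 * max 0 (t - z)))"
    by (intro continuous_intros g)
  have Wm: "W z \<le> W (z + 1)"
    proof (rule DERIV_nonneg_imp_nondecreasing[of z "z+1"])
      show "\<exists>d. (W has_real_derivative d) (at t) \<and> 0 \<le> d" for t
        using W[of t] g(2)[of t] by blast
    qed simp
  have "continuous_on {x..z+1} \<phi>"
    by (rule DERIV_imp_continuous_on[OF d[rule_format]])
  then have "continuous_on {x..z+1} (\<lambda>t. w t - \<phi> t)"
    by (intro continuous_on_diff continuous_on_subset[OF w]) auto
  then obtain y where y: "x < y" "y < z + 1" "\<forall>\<^sub>F t in nhds y. w t - \<phi> t \<le> w y - \<phi> y"
    by (rule interior_local_max[where r=z])
       (use xz e Wm in \<open>auto simp: \<phi>_def K_def algebra_simps\<close>)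
  have "(g y + e + K * (2 * max 0 (y - z)))\<^sup>2 \<le> (g y)\<^sup>2"
    by (rule eikonal_subD[OF sub d[rule_format] cd y(3)])
  then have "g y + e + K * (2 * max 0 (y - z)) \<le> g y"
    by (rule power2_le_imp_le) (rule g)
  moreover have "K * (2 * max 0 (y - z)) \<ge> 0"
    by (simp add: K_def)
  ultimately show False
    using e by linarith
qed

lemma eikonal_sub_abs_increment:
  assumes sub: "eikonal_sub (\<lambda>t. (g t)\<^sup>2) w" and w: "continuous_on UNIV w"
    and g: "continuous_on UNIV g" "\<And>t. g t \<ge> 0"
    and W: "\<And>t. (W has_real_derivative g t) (at t)" and "x \<le> z"
  shows "\<bar>w z - w x\<bar> \<le> W z - W x"
proof -
  \<comment> \<open>The opposite sign is the same estimate for the reflected function, whose slope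
    bound \<open>g (- t)\<close> has the primitive \<open>- W (- t)\<close>.\<close>
  have "w (- (- x)) - w (- (- z)) \<le> - W (- (- x)) - - W (- (- z))"
  proof (rule eikonal_sub_increment[where g="\<lambda>t. g (- t)" and W="\<lambda>t. - W (- t)" and w="\<lambda>t. w (- t)"])
    show "eikonal_sub (\<lambda>t. (g (- t))\<^sup>2) (\<lambda>t. w (- t))"
      by (rule eikonal_sub_reflect[OF sub])
    show "((\<lambda>t. - W (- t)) has_real_derivative g (- t)) (at t)" for t
      using DERIV_minus[OF W[of "- t", unfolded DERIV_mirror]] by simp
    show "- z \<le> - x" using \<open>x \<le> z\<close> by simp
  qed (simp_all add: continuous_on_reflect w g)
  with eikonal_sub_increment[OF assms] show ?thesis by (simp add: abs_le_iff)
qed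

text \<open>At an interior local minimum a constant touches \<open>w\<close> from below, which
  forces \<open>G \<le> 0\<close>. Hence \<open>w\<close> has no valley where \<open>G\<close> is
  positive.\<close>

lemma eikonal_super_quasiconcave:
  assumes super: "eikonal_super G w" and w: "continuous_on UNIV w"
    and G: "\<And>t. s < t \<Longrightarrow> t < r \<Longrightarrow> G t > 0" and "s \<le> x" "x \<le> r"
  shows "min (w s) (w r) \<le> w x"
proof (rule ccontr)
  assume "\<not> min (w s) (w r) \<le> w x"
  then have less: "w x < w s" "w x < w r" by auto
  then have "s \<noteq> x" "x \<noteq> r" by blast+
  with \<open>s \<le> x\<close> \<open>x \<le> r\<close> have sxr: "s < x" "x < r" by simp_all
  have "continuous_on {s..r} w" using w by (rule continuous_on_subset) simp
  then obtain y where y: "s < y" "y < r" "\<forall>\<^sub>F t in nhds y. w t \<ge> w y"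
    by (rule interior_local_min[OF _ sxr less[THEN less_imp_le]])
  have "0\<^sup>2 \<ge> G y"
    using eikonal_superD[OF super, of "\<lambda>_. 0" "\<lambda>_. 0" y] y(3) by simp
  with G[OF y(1,2)] show False by simp
qed

text \<open>Slope \<open>- g\<close> also solves the equation; monotonicity selects the increasing
  branch. If \<open>w\<close> gained less than \<open>W\<close>, a test function with slope strictly
  below \<open>g\<close> in absolute value would touch \<open>w\<close> from below.\<close>

lemma eikonal_super_increment:
  assumes super: "eikonal_super (\<lambda>t. (g t)\<^sup>2) w" and w: "continuous_on UNIV w"
    and g: "continuous_on UNIV g" "\<And>t. p \<le> t \<Longrightarrow> t \<le> q \<Longrightarrow> g t > 0"
    and W: "\<And>t. (W has_real_derivative g t) (at t)"
    and mono: "mono_on {p..q} w" and pq: "p \<le> q"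
  shows "W q - W p \<le> w q - w p"
proof -
  \<comment> \<open>The penalty needs room to the right of \<open>z\<close>; the endpoint
    \<open>z = q\<close> follows by continuity.\<close>
  have open_case: "W z - W p \<le> w z - w p" if z: "p \<le> z" "z < q" for z
  proof (rule ccontr)
    assume c: "\<not> W z - W p \<le> w z - w p"
    with z have pz: "p < z" by (cases "p = z") auto
    have Wm: "W s \<le> W t" if "p \<le> s" "s \<le> t" "t \<le> q" for s t
    proof (rule DERIV_nonneg_imp_nondecreasing[OF that(2)])
      fix r assume "s \<le> r" "r \<le> t"
      with that g(2)[of r] W[of r] show "\<exists>d. (W has_real_derivative d) (at r) \<and> 0 \<le> d"
        by (intro exI[of _ "g r"]) simp
    qed
    have W1: "W z < W q"
    proof (rule DERIV_pos_imp_increasing[OF z(2)])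
      fix r assume "z \<le> r" "r \<le> q"
      with z g(2)[of r] W[of r] show "\<exists>d. (W has_real_derivative d) (at r) \<and> 0 < d"
        by (intro exI[of _ "g r"]) simp
    qed
    have W0: "W p < W z"
    proof (rule DERIV_pos_imp_increasing[OF pz])
      fix r assume "p \<le> r" "r \<le> z"
      with z g(2)[of r] W[of r] show "\<exists>d. (W has_real_derivative d) (at r) \<and> 0 < d"
        by (intro exI[of _ "g r"]) simp
    qed
    have wz: "w p \<le> w z" "w z \<le> w q"
      using mono z by (auto simp: mono_on_def)
    \<comment> \<open>With this ratio \<open>w - m * W\<close> takes equal values at
      \<open>p\<close> and \<open>z\<close>; monotonicity of \<open>w\<close> gives
      \<open>0 \<le> m\<close>.\<close>
    define m where "m = (w z - w p) / (W z - W p)"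
    have m: "0 \<le> m" "m < 1" "m * (W z - W p) = w z - w p"
      using c W0 wz by (auto simp: m_def)
    \<comment> \<open>This value gives \<open>\<phi> q = \<phi> z\<close>, so that
      \<open>w z \<le> w q\<close> settles the right endpoint, while the factor
      \<open>1 - 2 * K * max 0 (W t - W z)\<close> stays within \<open>[-1, 1]\<close> on
      \<open>[p, q]\<close>.\<close>
    define K where "K = 1 / (W q - W z)"
    define \<phi> where "\<phi> = (\<lambda>t. m * (W t - K * (max 0 (W t - W z))\<^sup>2))"
    define \<phi>' where "\<phi>' = (\<lambda>t. m * (g t - K * (2 * max 0 (W t - W z) * g t)))"
    have d: "\<forall>t. (\<phi> has_real_derivative \<phi>' t) (at t)"
      unfolding \<phi>_def \<phi>'_def
      by (auto intro!: DERIV_cmult DERIV_diff W DERIV_chain2[OF DERIV_pos_part_square])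
    have Wc: "continuous_on UNIV W"
      by (rule DERIV_imp_continuous_on[OF W])
    have cd: "continuous_on UNIV \<phi>'"
      unfolding \<phi>'_def by (intro continuous_intros g Wc)
    have "continuous_on {p..q} (\<lambda>t. w t - \<phi> t)"
      unfolding \<phi>_def
      by (intro continuous_intros continuous_on_subset[OF w] continuous_on_subset[OF Wc]) auto
    moreover have "w z - \<phi> z \<le> w p - \<phi> p"
      using m W0 by (simp add: \<phi>_def algebra_simps)
    moreover have "w z - \<phi> z \<le> w q - \<phi> q"
    proof -
      have "K * (max 0 (W q - W z))\<^sup>2 = W q - W z"
        using W1 by (simp add: K_def power2_eq_square)
      then show ?thesis
        using wz by (simp add: \<phi>_def)
    qed
    ultimately obtain y where y: "p < y" "y < q" "\<forall>\<^sub>F t in nhds y. w t - \<phi> t \<ge> w y - \<phi> y"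
      using interior_local_min[of p q "\<lambda>t. w t - \<phi> t" z] pz z by blast
    have *: "(g y)\<^sup>2 \<le> (\<phi>' y)\<^sup>2"
      by (rule eikonal_superD[OF super d[rule_format] cd y(3)])
    have gy: "g y > 0" using g y by auto
    have "\<bar>1 - K * (2 * max 0 (W y - W z))\<bar> \<le> 1"
      using Wm[of y q] y W1 by (auto simp: K_def divide_simps max_def abs_le_iff)
    moreover have "\<phi>' y = g y * (m * (1 - K * (2 * max 0 (W y - W z))))"
      by (simp add: \<phi>'_def algebra_simps)
    ultimately have "\<bar>\<phi>' y\<bar> \<le> g y * m"
      using m gy by (simp add: abs_mult mult_left_le)
    also have "\<dots> < g y" using gy m by simp
    finally have "(\<phi>' y)\<^sup>2 < (g y)\<^sup>2"
      by (metis abs_ge_zero power2_abs power_strict_mono zero_less_numeral)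
    with * show False by simp
  qed
  show ?thesis
  proof (cases "p = q")
    case False
    with pq have "p < q" by simp
    have Wc: "continuous_on UNIV W"
      by (rule DERIV_imp_continuous_on[OF W])
    have "W q - W p - (w q - w p) \<le> 0"
    proof (rule continuous_le_on_closure[of "{p<..<q}" "\<lambda>z. W z - W p - (w z - w p)"])
      show "continuous_on (closure {p<..<q}) (\<lambda>z. W z - W p - (w z - w p))"
        by (intro continuous_intros continuous_on_subset[OF w] continuous_on_subset[OF Wc]) auto
      show "q \<in> closure {p<..<q}" using \<open>p < q\<close> by simp
      show "W z - W p - (w z - w p) \<le> 0" if "z \<in> {p<..<q}" for z
        using open_case[of z] that by auto
    qed
    then show ?thesis by simp
  qed simp
qed

text \<open>Both candidates bound \<open>w\<close> from above by the subsolution estimate. Without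
  valleys, \<open>w\<close> increases up to a maximum point \<open>y\<close> and decreases after it,
  so the first candidate is attained left of \<open>y\<close> and, by reflection, the second one
  right of \<open>y\<close>.\<close>

lemma eikonal_min_formula:
  assumes sub: "eikonal_sub (\<lambda>t. (g t)\<^sup>2) w" and super: "eikonal_super (\<lambda>t. (g t)\<^sup>2) w"
    and w: "continuous_on UNIV w"
    and g: "continuous_on UNIV g" "\<And>t. g t \<ge> 0" "\<And>t. p \<le> t \<Longrightarrow> t \<le> q \<Longrightarrow> g t > 0"
    and W: "\<And>t. (W has_real_derivative g t) (at t)" and x: "p \<le> x" "x \<le> q"
  shows "w x = min (w p + (W x - W p)) (w q + (W q - W x))"
proof -
  have up: "w x \<le> w p + (W x - W p)" "w x \<le> w q + (W q - W x)"
    using eikonal_sub_abs_increment[OF sub w g(1,2) W x(1)]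
      eikonal_sub_abs_increment[OF sub w g(1,2) W x(2)] by auto
  obtain y where y: "y \<in> {p..q}" "\<forall>t\<in>{p..q}. w t \<le> w y"
    using continuous_attains_sup[of "{p..q}" w] x continuous_on_subset[OF w subset_UNIV] by auto
  have qc: "min (w s) (w r) \<le> w t" if "p \<le> s" "s \<le> t" "t \<le> r" "r \<le> q" for s t r
  proof (rule eikonal_super_quasiconcave[OF super w])
    show "0 < (g t)\<^sup>2" if "s < t" "t < r" for t
      using g(3)[of t] that \<open>p \<le> s\<close> \<open>r \<le> q\<close> by simp
  qed (use that in auto)
  show ?thesis
  proof (cases "x \<le> y")
    case True
    have "mono_on {p..x} w"
    proof (rule mono_onI)
      fix s t assume "s \<in> {p..x}" "t \<in> {p..x}" "s \<le> t"
      then show "w s \<le> w t"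
        using qc[of s t y] y True by (auto simp: min_def split: if_splits)
    qed
    then have "W x - W p \<le> w x - w p"
      using x y by (intro eikonal_super_increment[OF super w g(1) _ W]) (auto intro: g(3))
    with up show ?thesis by simp
  next
    case False
    have "mono_on {- q..- x} (\<lambda>t. w (- t))"
    proof (rule mono_onI)
      fix s t assume "s \<in> {- q..- x}" "t \<in> {- q..- x}" "s \<le> t"
      then show "w (- s) \<le> w (- t)"
        using qc[of y "- t" "- s"] y(2)[rule_format, of "- s"] x y(1) False
        by (auto simp: min_def split: if_splits)
    qed
    then have "- W (- (- x)) - - W (- (- q)) \<le> w (- (- x)) - w (- (- q))"
    proof (intro eikonal_super_increment[where g="\<lambda>t. g (- t)" and W="\<lambda>t. - W (- t)" and w="\<lambda>t. w (- t)"])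
      show "eikonal_super (\<lambda>t. (g (- t))\<^sup>2) (\<lambda>t. w (- t))"
        by (rule eikonal_super_reflect[OF super])
      show "((\<lambda>t. - W (- t)) has_real_derivative g (- t)) (at t)" for t
        using DERIV_minus[OF W[of "- t", unfolded DERIV_mirror]] by simp
      show "0 < g (- t)" if "- q \<le> t" "t \<le> - x" for t
        using that x by (intro g(3)) simp_all
      show "- q \<le> - x" using x by simp
    qed (simp_all add: continuous_on_reflect w g(1))
    with up show ?thesis by simp
  qed
qed

lemma continuous_antiderivative_real:
  fixes g :: "real \<Rightarrow> real"
  assumes "continuous_on UNIV g"
  obtains W where "\<And>t. (W has_real_derivative g t) (at t)" "W 0 = 0"
proof -
  have "\<exists>F. \<forall>x::real. -\<infinity> < ereal x \<longrightarrow> ereal x < \<infinity> \<longrightarrow> (F has_vector_derivative g x) (at x)"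
    using assms by (intro einterval_antiderivative) (auto simp: continuous_on_eq_continuous_at)
  then obtain F where F: "\<And>x. (F has_real_derivative g x) (at x)"
    by (auto simp: has_real_derivative_iff_has_vector_derivative)
  show thesis
  proof (rule that[of "\<lambda>x. F x - F 0"])
    show "((\<lambda>x. F x - F 0) has_real_derivative g t) (at t)" for t
      using F by (auto intro!: derivative_eq_intros)
  qed simp
qed

section \<open>Primitives, nondegenerate maxima and logarithmic bounds\<close>

lemma increment_le_increment:
  fixes F H :: "real \<Rightarrow> real"
  assumes "x \<le> y"
    and "\<And>t. x \<le> t \<Longrightarrow> t \<le> y \<Longrightarrow> (F has_real_derivative f t) (at t)"
    and "\<And>t. x \<le> t \<Longrightarrow> t \<le> y \<Longrightarrow> (H has_real_derivative h t) (at t)"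
    and "\<And>t. x \<le> t \<Longrightarrow> t \<le> y \<Longrightarrow> f t \<le> h t"
  shows "F y - F x \<le> H y - H x"
proof -
  have "H x - F x \<le> H y - F y"
  proof (rule DERIV_nonneg_imp_nondecreasing[OF \<open>x \<le> y\<close>])
    fix t assume t: "x \<le> t" "t \<le> y"
    have "((\<lambda>t. H t - F t) has_real_derivative h t - f t) (at t)"
      using assms t by (intro DERIV_diff) auto
    with assms(4)[OF t] show "\<exists>d. ((\<lambda>t. H t - F t) has_real_derivative d) (at t) \<and> 0 \<le> d"
      by (intro exI conjI) auto
  qed
  then show ?thesis by simp
qed

lemma abs_increment_le_linear:
  fixes F :: "real \<Rightarrow> real"
  assumes "x \<le> y"
    and "\<And>t. x \<le> t \<Longrightarrow> t \<le> y \<Longrightarrow> (F has_real_derivative f t) (at t)"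
    and "\<And>t. x \<le> t \<Longrightarrow> t \<le> y \<Longrightarrow> \<bar>f t\<bar> \<le> k"
  shows "\<bar>F y - F x\<bar> \<le> k * (y - x)"
proof -
  have "F y - F x \<le> k * y - k * x"
    by (rule increment_le_increment[OF assms(1,2) DERIV_cmult_Id])
       (use assms in \<open>auto simp: abs_le_iff\<close>)
  moreover have "- F y - - F x \<le> k * y - k * x"
    by (rule increment_le_increment[OF assms(1) DERIV_minus[OF assms(2)] DERIV_cmult_Id])
       (use assms in \<open>auto simp: abs_le_iff\<close>)
  ultimately show ?thesis by (simp add: algebra_simps)
qed

lemma DERIV_ln_shift_right:
  fixes p e t :: real
  assumes "e > 0" "p \<le> t"
  shows "((\<lambda>t. m * ln (t - p + e)) has_real_derivative m / (t - p + e)) (at t)"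
  using assms by (auto intro!: derivative_eq_intros)

lemma DERIV_ln_shift_left:
  fixes p e t :: real
  assumes "e > 0" "t \<le> p"
  shows "((\<lambda>t. - m * ln (p - t + e)) has_real_derivative m / (p - t + e)) (at t)"
  using assms by (auto intro!: derivative_eq_intros)

text \<open>The model bound \<open>m / (t - p + e)\<close> integrates to a logarithm. The shift
  \<open>e\<close>, later \<open>sqrt l\<close>, keeps it finite at the zero \<open>p\<close> of
  \<open>V\<close>.\<close>

lemma abs_increment_le_log_right:
  fixes F :: "real \<Rightarrow> real"
  assumes "x \<le> y" "p \<le> x" "e > 0"
    and "\<And>t. x \<le> t \<Longrightarrow> t \<le> y \<Longrightarrow> (F has_real_derivative f t) (at t)"
    and "\<And>t. x \<le> t \<Longrightarrow> t \<le> y \<Longrightarrow> \<bar>f t\<bar> \<le> m / (t - p + e)"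
  shows "\<bar>F y - F x\<bar> \<le> m * (ln (y - p + e) - ln (x - p + e))"
proof -
  have "F y - F x \<le> m * ln (y - p + e) - m * ln (x - p + e)"
    by (rule increment_le_increment[OF assms(1,4) DERIV_ln_shift_right])
       (use assms in \<open>auto simp: abs_le_iff\<close>)
  moreover have "- F y - - F x \<le> m * ln (y - p + e) - m * ln (x - p + e)"
    by (rule increment_le_increment[OF assms(1) DERIV_minus[OF assms(4)] DERIV_ln_shift_right])
       (use assms in \<open>auto simp: abs_le_iff\<close>)
  ultimately show ?thesis by (simp add: algebra_simps)
qed

lemma abs_increment_le_log_left:
  fixes F :: "real \<Rightarrow> real"
  assumes "x \<le> y" "y \<le> p" "e > 0"
    and "\<And>t. x \<le> t \<Longrightarrow> t \<le> y \<Longrightarrow> (F has_real_derivative f t) (at t)"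
    and "\<And>t. x \<le> t \<Longrightarrow> t \<le> y \<Longrightarrow> \<bar>f t\<bar> \<le> m / (p - t + e)"
  shows "\<bar>F y - F x\<bar> \<le> m * (ln (p - x + e) - ln (p - y + e))"
proof -
  have "F y - F x \<le> - m * ln (p - y + e) - - m * ln (p - x + e)"
    by (rule increment_le_increment[OF assms(1,4) DERIV_ln_shift_left])
       (use assms in \<open>auto simp: abs_le_iff\<close>)
  moreover have "- F y - - F x \<le> - m * ln (p - y + e) - - m * ln (p - x + e)"
    by (rule increment_le_increment[OF assms(1) DERIV_minus[OF assms(4)] DERIV_ln_shift_left])
       (use assms in \<open>auto simp: abs_le_iff\<close>)
  ultimately show ?thesis by (simp add: algebra_simps)
qed

text \<open>Near \<open>p\<close>, Taylor's formula with vanishing value and slope compares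
  \<open>V\<close> with its second derivative. Away from \<open>p\<close>, compactness keeps
  \<open>- V\<close> above a positive constant. The upper bound uses the maximum of
  \<open>\<bar>V''\<bar>\<close>.\<close>

lemma nondegenerate_max_quadratic_bounds:
  fixes V V' V'' :: "real \<Rightarrow> real"
  assumes V': "\<And>x. (V has_real_derivative V' x) (at x)"
    and V'': "\<And>x. (V' has_real_derivative V'' x) (at x)"
    and cont: "continuous_on UNIV V''"
    and nonpos: "\<And>x. V x \<le> 0" and p: "V p = 0" "V'' p < 0" and r: "r > 0"
    and neg: "\<And>x. \<bar>x - p\<bar> \<le> r \<Longrightarrow> x \<noteq> p \<Longrightarrow> V x < 0"
  obtains k L where "k > 0" "L > 0" "\<And>x. \<bar>x - p\<bar> \<le> r \<Longrightarrow> k * (x - p)\<^sup>2 \<le> - V x"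
    "\<And>x. \<bar>x - p\<bar> \<le> r \<Longrightarrow> - V x \<le> L * (x - p)\<^sup>2"
proof -
  have V'p: "V' p = 0"
    using DERIV_local_max[OF V', of 1 p] nonpos p(1) by auto
  have taylor: "\<exists>t. \<bar>t - p\<bar> \<le> \<bar>x - p\<bar> \<and> V x = V'' t / 2 * (x - p)\<^sup>2" for x
  proof (cases "x = p")
    case False
    define d where "d = (\<lambda>m::nat. if m = 0 then V else if m = 1 then V' else V'')"
    have "(d m has_real_derivative d (Suc m) t) (at t)" if "m < 2" for m t
      using V' V'' that by (auto simp: d_def less_2_cases_iff)
    then obtain t where "if x < p then x < t \<and> t < p else p < t \<and> t < x"
      "V x = (\<Sum>m<2. d m p / fact m * (x - p) ^ m) + d 2 t / fact 2 * (x - p) ^ 2"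
      using Taylor[of 2 d V "min x p" "max x p" p x] False by (auto simp: d_def)
    then show ?thesis
      using p V'p by (intro exI[of _ t]) (auto simp: d_def eval_nat_numeral split: if_splits)
  qed (use p in auto)
  have "isCont V'' p" using cont by (simp add: continuous_on_eq_continuous_at)
  then have "\<forall>\<^sub>F t in nhds p. V'' t < V'' p / 2"
    using p(2) by (intro order_tendstoD(2)[where y="V'' p"]) (auto simp: isCont_def tendsto_at_iff_tendsto_nhds)
  then obtain d where d: "d > 0" "\<And>t. dist t p < d \<Longrightarrow> V'' t < V'' p / 2"
    by (auto simp: eventually_nhds_metric)
  have Vc: "continuous_on S V" for S
    by (rule DERIV_imp_continuous_on[OF V'])
  obtain m where m: "m > 0" "\<And>x. \<bar>x - p\<bar> \<le> r \<Longrightarrow> d \<le> \<bar>x - p\<bar> \<Longrightarrow> m \<le> - V x"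
  proof (cases "cball p r - ball p d = {}")
    case True
    then have "\<not> d \<le> \<bar>x - p\<bar>" if "\<bar>x - p\<bar> \<le> r" for x
      using that by (auto simp: dist_real_def set_eq_iff abs_minus_commute)
    then show thesis using that[of 1] by auto
  next
    case False
    moreover have "compact (cball p r - ball p d)" by (simp add: compact_diff)
    ultimately obtain y where y: "y \<in> cball p r - ball p d" "\<forall>x\<in>cball p r - ball p d. V x \<le> V y"
      using continuous_attains_sup[OF _ _ Vc] by blast
    then show thesis
      using neg[of y] d(1)
      by (intro that[of "- V y"]) (auto simp: dist_real_def abs_minus_commute)
  qed
  \<comment> \<open>The first entry serves distances below \<open>d\<close>, where
    \<open>V'' < V'' p / 2\<close>; the second serves the rest, where
    \<open>(x - p)\<^sup>2 \<le> r\<^sup>2\<close>.\<close>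
  define k where "k = min (- V'' p / 4) (m / r\<^sup>2)"
  have k: "k > 0" using p m r by (simp add: k_def)
  have lower: "k * (x - p)\<^sup>2 \<le> - V x" if x: "\<bar>x - p\<bar> \<le> r" for x
  proof (cases "\<bar>x - p\<bar> < d")
    case True
    obtain t where t: "\<bar>t - p\<bar> \<le> \<bar>x - p\<bar>" "V x = V'' t / 2 * (x - p)\<^sup>2"
      using taylor by blast
    with d True have "V'' t < V'' p / 2" by (simp add: dist_real_def)
    then have "k * (x - p)\<^sup>2 \<le> (- V'' t / 2) * (x - p)\<^sup>2"
      by (intro mult_right_mono) (auto simp: k_def)
    with t show ?thesis by simp
  next
    case False
    have "(x - p)\<^sup>2 \<le> r\<^sup>2" using x r by (simp add: abs_le_square_iff[symmetric])
    then have "k * (x - p)\<^sup>2 \<le> m / r\<^sup>2 * r\<^sup>2"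
      using k m by (intro mult_mono) (auto simp: k_def)
    also have "\<dots> = m" using r by simp
    finally show ?thesis using m(2)[of x] x False by linarith
  qed
  have "compact (V'' ` {p-r..p+r})"
    by (intro compact_continuous_image continuous_on_subset[OF cont]) auto
  then obtain N where N: "\<And>t. \<bar>t - p\<bar> \<le> r \<Longrightarrow> \<bar>V'' t\<bar> \<le> N" "N > 0"
    using compact_imp_bounded[THEN bounded_pos[THEN iffD1]] by (fastforce simp: abs_le_iff)
  have upper: "- V x \<le> N / 2 * (x - p)\<^sup>2" if x: "\<bar>x - p\<bar> \<le> r" for x
  proof -
    obtain t where t: "\<bar>t - p\<bar> \<le> \<bar>x - p\<bar>" "V x = V'' t / 2 * (x - p)\<^sup>2"
      using taylor by blast
    then have "- V'' t \<le> N" using N(1)[of t] x by linarith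
    then have "(- V'' t / 2) * (x - p)\<^sup>2 \<le> N / 2 * (x - p)\<^sup>2"
      by (intro mult_right_mono) auto
    with t show ?thesis by simp
  qed
  show thesis
    using that[OF k _ lower upper] N by simp
qed

text \<open>A primitive on the whole line has two-sided derivatives everywhere, and its increments
  replace integrals over intervals.\<close>

definition primitive :: "(real \<Rightarrow> real) \<Rightarrow> real \<Rightarrow> real" where
  "primitive g = (SOME W. (\<forall>t. (W has_real_derivative g t) (at t)) \<and> W 0 = 0)"

lemma primitive:
  assumes "continuous_on UNIV g"
  shows DERIV_primitive: "(primitive g has_real_derivative g t) (at t)"
    and primitive_0: "primitive g 0 = 0"
proof -
  have "\<exists>W. (\<forall>t. (W has_real_derivative g t) (at t)) \<and> W 0 = 0"
    using continuous_antiderivative_real[OF assms] by metis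
  then have "(\<forall>t. (primitive g has_real_derivative g t) (at t)) \<and> primitive g 0 = 0"
    unfolding primitive_def by (rule someI_ex)
  then show "(primitive g has_real_derivative g t) (at t)" "primitive g 0 = 0" by auto
qed

lemma periodic_frac:
  fixes f :: "real \<Rightarrow> 'b"
  assumes "periodic_fun_simple' f"
  shows "f (frac x) = f x"
proof -
  interpret periodic_fun_simple' f by fact
  show ?thesis unfolding frac_def by (rule minus_of_int)
qed

text \<open>Used to absorb errors of order \<open>l\<close> into
  \<open>l * \<bar>ln l\<bar>\<close>.\<close>

lemma eventually_abs_ln_ge: "\<forall>\<^sub>F l::real in at_right 0. k \<le> \<bar>ln l\<bar>"
proof -
  have "\<forall>\<^sub>F l::real in at_right 0. ln l \<le> - k"
    using ln_at_0 by (simp add: filterlim_at_bot)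
  then show ?thesis by eventually_elim simp
qed

lemma tendsto_mult_abs_ln_at_right_0: "((\<lambda>l::real. l * \<bar>ln l\<bar>) \<longlongrightarrow> 0) (at_right 0)"
proof -
  \<comment> \<open>Substituting \<open>l = inverse x\<close> turns the claim into the decay of
    \<open>ln x / x\<close> at infinity.\<close>
  have "((\<lambda>x::real. \<bar>ln x / x\<bar>) \<longlongrightarrow> \<bar>0\<bar>) at_top"
    by (intro tendsto_rabs ln_x_over_x_tendsto_0)
  moreover have "\<forall>\<^sub>F x::real in at_top. \<bar>ln x / x\<bar> = inverse x * \<bar>ln (inverse x)\<bar>"
    using eventually_gt_at_top[of 0]
    by eventually_elim (simp add: ln_inverse abs_mult divide_inverse mult.commute)
  ultimately have "((\<lambda>x::real. inverse x * \<bar>ln (inverse x)\<bar>) \<longlongrightarrow> 0) at_top"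
    by (auto intro: Lim_transform_eventually)
  then show ?thesis
    by (simp add: filterlim_at_right_to_top)
qed

section \<open>The discounted equation on the torus\<close>

locale discounted_torus =
  fixes V Q u\<^sub>0 :: "real \<Rightarrow> real" and A B a :: real and u :: "real \<Rightarrow> real \<Rightarrow> real"
  assumes V_periodic: "periodic_fun_simple' V"
    and V_smooth: "smooth V"
    and V_nonpos: "\<And>x. V x \<le> 0"
    and V_zeros: "{x \<in> {0..<1}. V x = 0} = {0, 1/2}"
    and V_nondeg_0: "(deriv ^^ 2) V 0 < 0"
    and V_nondeg_half: "(deriv ^^ 2) V (1/2) < 0"
    and Q: "Q = (\<lambda>x. sqrt (- 2 * V x))"
    and A: "A = integral {0..1/2} Q"
    and B: "B = integral {1/2..1} Q"
    and A_less_B: "A < B"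
    and a: "a = (3 * A + B) / 2"
    and u_solution:
      "\<And>l. l > 0 \<Longrightarrow> torus_viscosity_solution (\<lambda>x r p. l * r + hamiltonian V a x p) (u l)"
    and u\<^sub>0_limit: "\<And>x. ((\<lambda>l. u l x) \<longlongrightarrow> u\<^sub>0 x) (at_right 0)"
begin

text \<open>The discounted equation solved for the squared slope of \<open>w l\<close>. The unknown
  also occurs in \<open>G l\<close>, but the eikonal lemmas need \<open>G l\<close> only as a given
  continuous function.\<close>

definition G :: "real \<Rightarrow> real \<Rightarrow> real" where "G l x = (Q x)\<^sup>2 - 2 * l * u l x"
definition g :: "real \<Rightarrow> real \<Rightarrow> real" where "g l x = sqrt (G l x)"
definition w :: "real \<Rightarrow> real \<Rightarrow> real" where "w l x = u l x + a * x"
definition W :: "real \<Rightarrow> real \<Rightarrow> real" where "W l = primitive (g l)"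
definition W\<^sub>Q :: "real \<Rightarrow> real" where "W\<^sub>Q = primitive Q"

lemma V_period: "V (x + 1) = V x"
  using V_periodic by (simp add: periodic_fun_simple'_def)

lemma DERIV_V: "(V has_real_derivative deriv V x) (at x)"
  "(deriv V has_real_derivative (deriv ^^ 2) V x) (at x)"
  "((deriv ^^ 2) V has_real_derivative (deriv ^^ 3) V x) (at x)"
proof -
  have *: "((deriv ^^ k) V has_real_derivative (deriv ^^ Suc k) V x) (at x)" for k
    using V_smooth by (simp add: smooth_def DERIV_deriv_iff_field_differentiable)
  from *[of 0] *[of 1] *[of 2]
  show "(V has_real_derivative deriv V x) (at x)"
    "(deriv V has_real_derivative (deriv ^^ 2) V x) (at x)"
    "((deriv ^^ 2) V has_real_derivative (deriv ^^ 3) V x) (at x)"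
    by (simp_all add: numeral_2_eq_2 numeral_3_eq_3)
qed

lemma Q_nonneg: "0 \<le> Q x" and Q_square: "(Q x)\<^sup>2 = - 2 * V x"
  using V_nonpos[of x] by (simp_all add: Q)

lemma continuous_on_Q: "continuous_on S Q"
  unfolding Q by (intro continuous_intros DERIV_imp_continuous_on[OF DERIV_V(1)])

lemma DERIV_W\<^sub>Q: "(W\<^sub>Q has_real_derivative Q t) (at t)" and W\<^sub>Q_0: "W\<^sub>Q 0 = 0"
  unfolding W\<^sub>Q_def using primitive[OF continuous_on_Q] by auto

lemma integral_Q:
  assumes "x \<le> y"
  shows "integral {x..y} Q = W\<^sub>Q y - W\<^sub>Q x"
proof (rule integral_unique, rule fundamental_theorem_of_calculus[OF assms])
  show "(W\<^sub>Q has_vector_derivative Q t) (at t within {x..y})" for t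
    using DERIV_W\<^sub>Q[of t]
    by (simp add: has_real_derivative_iff_has_vector_derivative has_vector_derivative_at_within)
qed

lemma W\<^sub>Q_half: "W\<^sub>Q (1/2) = A" and W\<^sub>Q_1: "W\<^sub>Q 1 = A + B"
  using integral_Q[of 0 "1/2"] integral_Q[of "1/2" 1] by (simp_all add: A B W\<^sub>Q_0)

lemma A_nonneg: "0 \<le> A" and a_pos: "0 < a"
proof -
  show "0 \<le> A"
    unfolding A by (rule integral_nonneg) (auto intro: Q_nonneg integrable_continuous_real continuous_on_Q)
  with A_less_B show "0 < a" by (simp add: a)
qed

lemma V_neg:
  assumes "frac x \<noteq> 0" "frac x \<noteq> 1/2"
  shows "V x < 0"
proof -
  have "frac x \<in> {0..<1}" by (simp add: frac_lt_1)
  with V_zeros assms have "V (frac x) \<noteq> 0" by blast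
  then show ?thesis
    using periodic_frac[OF V_periodic, of x] V_nonpos[of x] by simp
qed

lemma V_at_zeros: "V 0 = 0" "V (1/2) = 0" "V 1 = 0"
  using V_zeros V_period[of 0] by auto

text \<open>\<open>Q\<close> is the square root of \<open>- 2 * V\<close>, which is comparable to
  the squared distance from a nondegenerate zero. With radius 1/4 the neighbourhoods of 0, 1/2 and 1
  cover a whole period.\<close>

lemma Q_growth:
  obtains c L where "c > 0" "L > 0" "\<And>x. \<bar>x\<bar> \<le> 1/4 \<Longrightarrow> c * \<bar>x\<bar> \<le> Q x"
    "\<And>x. \<bar>x - 1/2\<bar> \<le> 1/4 \<Longrightarrow> c * \<bar>x - 1/2\<bar> \<le> Q x"
    "\<And>x. \<bar>x - 1/2\<bar> \<le> 1/4 \<Longrightarrow> Q x \<le> L * \<bar>x - 1/2\<bar>"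
proof -
  have frac_small: "frac x = x" if "0 \<le> x" "x < 1" for x :: real
    using that by (simp add: frac_eq)
  have frac_neg: "frac x = x + 1" if "-1 \<le> x" "x < 0" for x :: real
    using frac_unique_iff[of x "x + 1"] that by auto
  have neg0: "V x < 0" if "\<bar>x - 0\<bar> \<le> 1/4" "x \<noteq> 0" for x
    using that by (cases "x < 0") (auto intro!: V_neg simp: frac_small frac_neg)
  have neg1: "V x < 0" if "\<bar>x - 1/2\<bar> \<le> 1/4" "x \<noteq> 1/2" for x
  proof -
    have "frac x = x" using that(1) unfolding abs_le_iff by (intro frac_small) linarith+
    then show ?thesis using that by (intro V_neg) auto
  qed
  have cont: "continuous_on UNIV ((deriv ^^ 2) V)"
    by (rule DERIV_imp_continuous_on[OF DERIV_V(3)])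
  obtain k\<^sub>0 L\<^sub>0 where k0: "k\<^sub>0 > 0" "\<And>x. \<bar>x - 0\<bar> \<le> 1/4 \<Longrightarrow> k\<^sub>0 * (x - 0)\<^sup>2 \<le> - V x"
    using nondegenerate_max_quadratic_bounds[OF DERIV_V(1,2) cont V_nonpos V_at_zeros(1)
        V_nondeg_0 _ neg0] by (metis zero_less_divide_1_iff zero_less_numeral)
  obtain k\<^sub>1 L\<^sub>1 where k1: "k\<^sub>1 > 0" "L\<^sub>1 > 0" "\<And>x. \<bar>x - 1/2\<bar> \<le> 1/4 \<Longrightarrow> k\<^sub>1 * (x - 1/2)\<^sup>2 \<le> - V x"
    "\<And>x. \<bar>x - 1/2\<bar> \<le> 1/4 \<Longrightarrow> - V x \<le> L\<^sub>1 * (x - 1/2)\<^sup>2"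
    using nondegenerate_max_quadratic_bounds[OF DERIV_V(1,2) cont V_nonpos V_at_zeros(2)
        V_nondeg_half _ neg1] by (metis zero_less_divide_1_iff zero_less_numeral)
  define c where "c = min (sqrt (2 * k\<^sub>0)) (sqrt (2 * k\<^sub>1))"
  have lower: "c * \<bar>x - p\<bar> \<le> Q x" if "k * (x - p)\<^sup>2 \<le> - V x" "c \<le> sqrt (2 * k)" for x p k
  proof -
    have "c * \<bar>x - p\<bar> \<le> sqrt (2 * k) * \<bar>x - p\<bar>"
      using that by (intro mult_right_mono) auto
    also have "\<dots> = sqrt (2 * k * (x - p)\<^sup>2)"
      by (simp add: real_sqrt_mult)
    also have "\<dots> \<le> Q x"
      unfolding Q using that by (intro real_sqrt_le_mono) simp
    finally show ?thesis .
  qed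
  show thesis
  proof (rule that)
    show "c > 0" using k0 k1 by (simp add: c_def)
    show "sqrt (2 * L\<^sub>1) > 0" using k1 by simp
    show "c * \<bar>x\<bar> \<le> Q x" if "\<bar>x\<bar> \<le> 1/4" for x
      using lower[of k\<^sub>0 x 0] k0(2)[of x] that by (simp add: c_def)
    show "c * \<bar>x - 1/2\<bar> \<le> Q x" if "\<bar>x - 1/2\<bar> \<le> 1/4" for x
      using lower[of k\<^sub>1 x "1/2"] k1(3)[OF that] by (simp add: c_def)
    show "Q x \<le> sqrt (2 * L\<^sub>1) * \<bar>x - 1/2\<bar>" if "\<bar>x - 1/2\<bar> \<le> 1/4" for x
    proof -
      have "Q x \<le> sqrt (2 * L\<^sub>1 * (x - 1/2)\<^sup>2)"
        unfolding Q using k1(4)[OF that] by (intro real_sqrt_le_mono) simp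
      then show ?thesis by (simp add: real_sqrt_mult)
    qed
  qed
qed

section \<open>Basic properties of the discounted solutions\<close>

lemma u_periodic: "l > 0 \<Longrightarrow> periodic_fun_simple' (u l)"
  using u_solution[of l] unfolding torus_viscosity_solution_def by blast

lemma u_period: "l > 0 \<Longrightarrow> u l (x + 1) = u l x"
  by (rule periodic_fun_simple'.plus_period[OF u_periodic])

lemma continuous_on_u: "l > 0 \<Longrightarrow> continuous_on S (u l)"
  using u_solution[of l] continuous_on_subset by (auto simp: torus_viscosity_solution_def)

lemma Q_period: "Q (x + 1) = Q x"
  by (simp add: Q V_period)

lemma G_period: "l > 0 \<Longrightarrow> G l (x + 1) = G l x"
  by (simp add: G_def Q_period u_period)

lemma w_period: "l > 0 \<Longrightarrow> w l (x + 1) = w l x + a"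
  by (simp add: w_def u_period distrib_left)

lemma continuous_on_w: "l > 0 \<Longrightarrow> continuous_on S (w l)"
  unfolding w_def by (intro continuous_intros continuous_on_u)

lemma continuous_on_G: "l > 0 \<Longrightarrow> continuous_on S (G l)"
  unfolding G_def by (intro continuous_intros continuous_on_u continuous_on_Q)

lemma continuous_on_g: "l > 0 \<Longrightarrow> continuous_on S (g l)"
  unfolding g_def by (intro continuous_intros continuous_on_G)

text \<open>A test function \<open>\<phi>\<close> for \<open>w l\<close> becomes the test function
  \<open>\<phi> y - a * y\<close> for \<open>u l\<close>; its slope \<open>\<phi>' - a\<close>
  cancels the shift in the Hamiltonian.\<close>

lemma
  assumes l: "l > 0"
  shows eikonal_sub_w: "eikonal_sub (G l) (w l)" and eikonal_super_w: "eikonal_super (G l) (w l)"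
proof -
  have test: "(\<lambda>y. \<phi> y - a * y) C1_differentiable_on UNIV" "deriv (\<lambda>y. \<phi> y - a * y) x = \<phi>' x - a"
    if "\<forall>t. (\<phi> has_real_derivative \<phi>' t) (at t)" "continuous_on UNIV \<phi>'" for \<phi> \<phi>' x
  proof -
    have d: "((\<lambda>y. \<phi> y - a * y) has_real_derivative \<phi>' t - a) (at t)" for t
      using that(1) by (intro DERIV_diff DERIV_cmult_Id) simp
    then show "deriv (\<lambda>y. \<phi> y - a * y) x = \<phi>' x - a"
      by (rule DERIV_imp_deriv)
    have "continuous_on UNIV (\<lambda>t. \<phi>' t - a)"
      by (intro continuous_intros that(2))
    with d show "(\<lambda>y. \<phi> y - a * y) C1_differentiable_on UNIV"
      unfolding C1_differentiable_on_def has_real_derivative_iff_has_vector_derivative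
      by (intro exI[of _ "\<lambda>t. \<phi>' t - a"]) simp
  qed
  show "eikonal_sub (G l) (w l)"
    unfolding eikonal_sub_def
  proof (intro allI impI)
    fix \<phi> \<phi>' :: "real \<Rightarrow> real" and x
    assume d: "\<forall>t. (\<phi> has_real_derivative \<phi>' t) (at t)" "continuous_on UNIV \<phi>'"
      and e: "\<forall>\<^sub>F y in nhds x. w l y - \<phi> y \<le> w l x - \<phi> x"
    have sol: "viscosity_subsolution (\<lambda>x r p. l * r + hamiltonian V a x p) (u l)"
      using u_solution[OF l] by (simp add: torus_viscosity_solution_def)
    have touch: "\<forall>\<^sub>F y in nhds x. u l y - (\<phi> y - a * y) \<le> u l x - (\<phi> x - a * x)"
      using e by (simp add: w_def algebra_simps)
    have "l * u l x + hamiltonian V a x (\<phi>' x - a) \<le> 0"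
      using sol[unfolded viscosity_subsolution_def, rule_format, OF test(1)[OF d] touch]
      by (simp add: test(2)[OF d])
    then show "(\<phi>' x)\<^sup>2 \<le> G l x"
      by (simp add: hamiltonian_def G_def Q_square)
  qed
  show "eikonal_super (G l) (w l)"
    unfolding eikonal_super_def
  proof (intro allI impI)
    fix \<phi> \<phi>' :: "real \<Rightarrow> real" and x
    assume d: "\<forall>t. (\<phi> has_real_derivative \<phi>' t) (at t)" "continuous_on UNIV \<phi>'"
      and e: "\<forall>\<^sub>F y in nhds x. w l y - \<phi> y \<ge> w l x - \<phi> x"
    have sol: "viscosity_supersolution (\<lambda>x r p. l * r + hamiltonian V a x p) (u l)"
      using u_solution[OF l] by (simp add: torus_viscosity_solution_def)
    have touch: "\<forall>\<^sub>F y in nhds x. u l y - (\<phi> y - a * y) \<ge> u l x - (\<phi> x - a * x)"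
      using e by (simp add: w_def algebra_simps)
    have "l * u l x + hamiltonian V a x (\<phi>' x - a) \<ge> 0"
      using sol[unfolded viscosity_supersolution_def, rule_format, OF test(1)[OF d] touch]
      by (simp add: test(2)[OF d])
    then show "(\<phi>' x)\<^sup>2 \<ge> G l x"
      by (simp add: hamiltonian_def G_def Q_square)
  qed
qed

lemma G_nonneg: "l > 0 \<Longrightarrow> 0 \<le> G l x"
  by (rule eikonal_sub_nonneg[OF eikonal_sub_w continuous_on_w continuous_on_G])

lemma g_nonneg: "l > 0 \<Longrightarrow> 0 \<le> g l x" and g_square: "l > 0 \<Longrightarrow> (g l x)\<^sup>2 = G l x"
  using G_nonneg by (simp_all add: g_def)

lemma g_pos_iff: "0 < g l x \<longleftrightarrow> 0 < G l x"
  by (simp add: g_def)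

lemma DERIV_W: "l > 0 \<Longrightarrow> (W l has_real_derivative g l t) (at t)" and W_0: "l > 0 \<Longrightarrow> W l 0 = 0"
  unfolding W_def using primitive[OF continuous_on_g] by auto

lemma abs_w_increment:
  assumes l: "l > 0" and "x \<le> z"
  shows "\<bar>w l z - w l x\<bar> \<le> W l z - W l x"
  by (rule eikonal_sub_abs_increment[where g="g l"])
     (use assms in \<open>simp_all add: g_square g_nonneg eikonal_sub_w continuous_on_w continuous_on_g DERIV_W\<close>)

lemma w_min_formula:
  assumes l: "l > 0" and "p \<le> x" "x \<le> q" and "\<And>t. p \<le> t \<Longrightarrow> t \<le> q \<Longrightarrow> 0 < G l t"
  shows "w l x = min (w l p + (W l x - W l p)) (w l q + (W l q - W l x))"
  by (rule eikonal_min_formula[where g="g l"])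
     (use assms in \<open>simp_all add: g_square g_nonneg g_pos_iff eikonal_sub_w eikonal_super_w
        continuous_on_w continuous_on_g DERIV_W\<close>)

text \<open>At 0 the potential vanishes, so \<open>G l 0 \<ge> 0\<close> is a sign condition on
  \<open>u l 0\<close>.\<close>

lemma u_at_0_le: "l > 0 \<Longrightarrow> u l 0 \<le> 0"
  using G_nonneg[of l 0] V_at_zeros by (simp add: G_def Q_square mult_le_0_iff)

lemma Q_bounded: obtains M where "M > 0" "\<And>x. Q x \<le> M"
proof -
  have "compact (Q ` {0..1})"
    by (intro compact_continuous_image continuous_on_Q) simp
  then obtain M where M: "M > 0" "\<forall>y\<in>Q ` {0..1}. norm y \<le> M"
    using compact_imp_bounded[THEN bounded_pos[THEN iffD1]] by blast
  have per: "periodic_fun_simple' Q" by standard (rule Q_period)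
  have "Q x \<le> M" for x
  proof -
    have "frac x \<in> {0..1}" using frac_lt_1[of x] by simp
    with M have "\<bar>Q (frac x)\<bar> \<le> M" by simp
    then have "Q (frac x) \<le> M" by simp
    then show ?thesis by (simp add: periodic_frac[OF per])
  qed
  with M that show thesis by blast
qed

text \<open>At a minimum of \<open>u l\<close> the line of slope \<open>a\<close> touches
  \<open>w l\<close> from below, whence \<open>G l \<le> a\<^sup>2\<close> there.\<close>

lemma discounted_u_lower:
  assumes l: "l > 0"
  shows "- 2 * l * u l x \<le> a\<^sup>2"
proof -
  obtain m where m: "m \<in> {0..1}" "\<forall>y\<in>{0..1}. u l m \<le> u l y"
    using continuous_attains_inf[of "{0..1}" "u l"] continuous_on_u[OF l] by auto
  have min: "u l m \<le> u l y" for y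
  proof -
    have "frac y \<in> {0..1}" using frac_lt_1[of y] by simp
    with m have "u l m \<le> u l (frac y)" by blast
    then show ?thesis by (simp add: periodic_frac[OF u_periodic[OF l]])
  qed
  have "a\<^sup>2 \<ge> G l m"
    by (rule eikonal_superD[OF eikonal_super_w[OF l], of "\<lambda>t. a * t" "\<lambda>_. a"])
       (auto simp: w_def min intro: DERIV_cmult_Id)
  then have "- 2 * l * u l m \<le> a\<^sup>2"
    using zero_le_power2[of "Q m"] unfolding G_def by linarith
  moreover have "2 * l * u l m \<le> 2 * l * u l x"
    using min l by (intro mult_left_mono) auto
  ultimately show ?thesis by linarith
qed

text \<open>The lower bound on \<open>l * u l\<close> bounds \<open>g l\<close> independently of
  \<open>l\<close>, and with it the slopes of \<open>w l\<close> and \<open>u l\<close>. Convergence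
  at the single point 0 and the Lipschitz bound over one period then bound \<open>u l\<close>
  itself.\<close>

lemma uniform_bounds:
  obtains K where "K > 0" "\<And>l x. l > 0 \<Longrightarrow> g l x \<le> K"
    "\<And>l x y. l > 0 \<Longrightarrow> \<bar>u l x - u l y\<bar> \<le> K * \<bar>x - y\<bar>"
    "\<And>l x y. l > 0 \<Longrightarrow> \<bar>w l x - w l y\<bar> \<le> K * \<bar>x - y\<bar>"
    "\<forall>\<^sub>F l in at_right 0. \<forall>x. \<bar>u l x\<bar> \<le> K"
proof -
  obtain M where M: "M > 0" "\<And>x. Q x \<le> M" using Q_bounded by blast
  define N where "N = sqrt (M\<^sup>2 + a\<^sup>2)"
  have N: "N \<ge> 0" by (simp add: N_def)
  have gN: "g l x \<le> N" if l: "l > 0" for l x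
    unfolding g_def N_def G_def
    using discounted_u_lower[OF l, of x] power_mono[OF M(2)[of x] Q_nonneg, of 2]
    by (intro real_sqrt_le_mono) linarith
  have W_N: "W l z - W l x \<le> N * (z - x)" if l: "l > 0" "x \<le> z" for l x z
    using increment_le_increment[OF l(2) DERIV_W[OF l(1)] DERIV_cmult_Id[of N] gN[OF l(1)]]
    by (simp add: algebra_simps)
  have wN: "\<bar>w l x - w l y\<bar> \<le> N * \<bar>x - y\<bar>" if l: "l > 0" for l x y
  proof (cases "x \<le> y")
    case True
    with abs_w_increment[OF l True] W_N[OF l True] show ?thesis by (simp add: abs_minus_commute)
  next
    case False
    with abs_w_increment[OF l, of y x] W_N[OF l, of y x] show ?thesis by simp
  qed
  have uN: "\<bar>u l x - u l y\<bar> \<le> (N + a) * \<bar>x - y\<bar>" if l: "l > 0" for l x y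
  proof -
    have "u l x - u l y = (w l x - w l y) - a * (x - y)" by (simp add: w_def algebra_simps)
    then have "\<bar>u l x - u l y\<bar> \<le> \<bar>w l x - w l y\<bar> + \<bar>a * (x - y)\<bar>" by linarith
    also have "\<dots> \<le> N * \<bar>x - y\<bar> + a * \<bar>x - y\<bar>"
      using wN[OF l] a_pos by (simp add: abs_mult)
    finally show ?thesis by (simp add: algebra_simps)
  qed
  define K where "K = N + a + \<bar>u\<^sub>0 0\<bar> + 1"
  have K: "N \<le> K" "N + a \<le> K" "K > 0" using N a_pos by (auto simp: K_def)
  have "\<forall>\<^sub>F l in at_right 0. dist (u l 0) (u\<^sub>0 0) < 1"
    using u\<^sub>0_limit[of 0] by (rule tendstoD) simp
  moreover have "\<forall>\<^sub>F l::real in at_right 0. l > 0" by (rule eventually_at_right_less)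
  ultimately have bounded: "\<forall>\<^sub>F l in at_right 0. \<forall>x. \<bar>u l x\<bar> \<le> K"
  proof eventually_elim
    case (elim l)
    show ?case
    proof
      fix x
      have "(N + a) * \<bar>frac x - 0\<bar> \<le> N + a"
        using frac_lt_1[of x] frac_ge_0[of x] N a_pos by (intro mult_left_le) auto
      with uN[OF elim(2), of "frac x" 0] have "\<bar>u l (frac x)\<bar> \<le> K"
        using elim(1) unfolding K_def dist_real_def by linarith
      then show "\<bar>u l x\<bar> \<le> K" by (simp add: periodic_frac[OF u_periodic[OF elim(2)]])
    qed
  qed
  show thesis
  proof (rule that[OF K(3) _ _ _ bounded])
    show "g l x \<le> K" if "l > 0" for l x using gN[OF that, of x] K by linarith
    show "\<bar>u l x - u l y\<bar> \<le> K * \<bar>x - y\<bar>" if "l > 0" for l x y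
      using uN[OF that, of x y] mult_right_mono[OF K(2), of "\<bar>x - y\<bar>"] by linarith
    show "\<bar>w l x - w l y\<bar> \<le> K * \<bar>x - y\<bar>" if "l > 0" for l x y
      using wN[OF that, of x y] mult_right_mono[OF K(1), of "\<bar>x - y\<bar>"] by linarith
  qed
qed

end

section \<open>Estimates with constants independent of the discount\<close>

locale discounted_torus_bounds = discounted_torus +
  fixes K c L :: real
  assumes K: "K > 0" and c: "c > 0" and L: "L > 0"
    and g_le: "\<And>l x. l > 0 \<Longrightarrow> g l x \<le> K"
    and u_lipschitz: "\<And>l x y. l > 0 \<Longrightarrow> \<bar>u l x - u l y\<bar> \<le> K * \<bar>x - y\<bar>"
    and w_lipschitz: "\<And>l x y. l > 0 \<Longrightarrow> \<bar>w l x - w l y\<bar> \<le> K * \<bar>x - y\<bar>"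
    and u_bounded: "\<forall>\<^sub>F l in at_right 0. \<forall>x. \<bar>u l x\<bar> \<le> K"
    and Q_growth_0: "\<And>x. \<bar>x\<bar> \<le> 1/4 \<Longrightarrow> c * \<bar>x\<bar> \<le> Q x"
    and Q_growth_half: "\<And>x. \<bar>x - 1/2\<bar> \<le> 1/4 \<Longrightarrow> c * \<bar>x - 1/2\<bar> \<le> Q x"
    and Q_le_half: "\<And>x. \<bar>x - 1/2\<bar> \<le> 1/4 \<Longrightarrow> Q x \<le> L * \<bar>x - 1/2\<bar>"
begin

text \<open>The common scale of the gaps: \<open>- \<delta>\<close> will be the limit of
  \<open>u l (1/2)\<close>, and the total \<open>A + B\<close> exceeds the gain \<open>a\<close> per
  period by \<open>2 * \<delta>\<close>.\<close>

definition \<delta> :: real where "\<delta> = (B - A) / 4"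

lemma \<delta>: "\<delta> > 0" "A - a / 2 = - \<delta>" "A + B - a = 2 * \<delta>" "B - A = 4 * \<delta>"
  using A_less_B by (simp_all add: \<delta>_def a field_simps)

text \<open>The smallness conditions in one place. The fourth makes the crude error of the primitive
  less than \<open>\<delta> / 2\<close>; the fifth limits the variation of \<open>u l\<close> where
  \<open>Q\<close> may be below \<open>sqrt (2 * K * l)\<close> near 1/2; the last keeps the
  exceptional neighbourhood of 0 inside radius 1/4.\<close>

definition good :: "real \<Rightarrow> bool" where
  "good l \<longleftrightarrow> 0 < l \<and> l < 1/2 \<and> (\<forall>x. \<bar>u l x\<bar> \<le> K) \<and> sqrt (2 * K * l) < \<delta> / 2 \<and>
     K * sqrt (2 * K * l) / c < \<delta> / 4 \<and> 4 * K / c\<^sup>2 * l < 1/4"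

lemma eventually_good: "\<forall>\<^sub>F l in at_right 0. good l"
proof -
  have id: "((\<lambda>l::real. l) \<longlongrightarrow> 0) (at_right 0)" by (rule tendsto_ident_at)
  have "((\<lambda>l. sqrt (2 * K * l)) \<longlongrightarrow> sqrt (2 * K * 0)) (at_right 0)"
    by (intro tendsto_intros id)
  then have 1: "\<forall>\<^sub>F l in at_right 0. sqrt (2 * K * l) < \<delta> / 2"
    by (rule order_tendstoD(2)) (use \<delta>(1) in simp)
  have "((\<lambda>l. K * sqrt (2 * K * l) / c) \<longlongrightarrow> K * sqrt (2 * K * 0) / c) (at_right 0)"
    using c by (intro tendsto_intros id) auto
  then have 2: "\<forall>\<^sub>F l in at_right 0. K * sqrt (2 * K * l) / c < \<delta> / 4"
    by (rule order_tendstoD(2)) (use \<delta>(1) in simp)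
  have "((\<lambda>l. 4 * K / c\<^sup>2 * l) \<longlongrightarrow> 4 * K / c\<^sup>2 * 0) (at_right 0)"
    by (intro tendsto_intros id)
  then have 3: "\<forall>\<^sub>F l in at_right 0. 4 * K / c\<^sup>2 * l < 1/4"
    by (rule order_tendstoD(2)) simp
  have 4: "\<forall>\<^sub>F l::real in at_right 0. l < 1/2"
    using id by (rule order_tendstoD(2)) simp
  have 5: "\<forall>\<^sub>F l::real in at_right 0. 0 < l" by (rule eventually_at_right_less)
  show ?thesis
    using 1 2 3 4 5 u_bounded by eventually_elim (simp add: good_def)
qed

lemma goodD:
  assumes "good l"
  shows "0 < l" "l < 1/2" "\<bar>u l x\<bar> \<le> K" "sqrt (2 * K * l) < \<delta> / 2"
    "K * sqrt (2 * K * l) / c < \<delta> / 4" "4 * K / c\<^sup>2 * l < 1/4"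
  using assms by (simp_all add: good_def)

lemma g_diff_times_sum: "l > 0 \<Longrightarrow> (g l x - Q x) * (g l x + Q x) = - 2 * l * u l x"
  using g_square[of l x] by (simp add: G_def power2_eq_square algebra_simps)

lemma abs_g_diff_times_sum:
  assumes "good l"
  shows "\<bar>g l x - Q x\<bar> * (g l x + Q x) \<le> 2 * K * l"
proof -
  note l = goodD(1)[OF assms]
  have "\<bar>g l x - Q x\<bar> * (g l x + Q x) = \<bar>(g l x - Q x) * (g l x + Q x)\<bar>"
    using g_nonneg[OF l, of x] Q_nonneg[of x] by (simp add: abs_mult)
  also have "\<dots> = 2 * l * \<bar>u l x\<bar>"
    using l by (simp add: g_diff_times_sum abs_mult)
  also have "\<dots> \<le> 2 * l * K"
    using goodD[OF assms] by (intro mult_left_mono) auto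
  finally show ?thesis by (simp add: mult_ac)
qed

text \<open>Since \<open>g l\<close> and \<open>Q\<close> are nonnegative,
  \<open>\<bar>g l x - Q x\<bar> \<le> g l x + Q x\<close>, so the square is bounded by the
  difference of squares.\<close>

lemma abs_g_diff_le:
  assumes "good l"
  shows "\<bar>g l x - Q x\<bar> \<le> sqrt (2 * K * l)"
proof (rule real_le_rsqrt)
  have "\<bar>g l x - Q x\<bar>\<^sup>2 \<le> \<bar>g l x - Q x\<bar> * (g l x + Q x)"
    unfolding power2_eq_square
    using g_nonneg[OF goodD(1)[OF assms], of x] Q_nonneg[of x] by (intro mult_left_mono) auto
  with abs_g_diff_times_sum[OF assms, of x] show "\<bar>g l x - Q x\<bar>\<^sup>2 \<le> 2 * K * l" by linarith
qed

definition D :: "real \<Rightarrow> real \<Rightarrow> real" where "D l x = W l x - W\<^sub>Q x"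

lemma DERIV_D: "l > 0 \<Longrightarrow> (D l has_real_derivative g l t - Q t) (at t)"
  unfolding D_def by (intro DERIV_diff DERIV_W DERIV_W\<^sub>Q)

lemma D_0: "l > 0 \<Longrightarrow> D l 0 = 0"
  by (simp add: D_def W_0 W\<^sub>Q_0)

text \<open>A crude bound, sufficient for all comparisons with the fixed gap
  \<open>\<delta>\<close>.\<close>

lemma abs_D_le_soft:
  assumes "good l" "0 \<le> x" "x \<le> 1"
  shows "\<bar>D l x\<bar> \<le> sqrt (2 * K * l)"
proof -
  have "\<bar>D l x - D l 0\<bar> \<le> sqrt (2 * K * l) * (x - 0)"
    by (rule abs_increment_le_linear[OF assms(2) DERIV_D abs_g_diff_le])
       (use assms goodD(1) in auto)
  also have "\<dots> \<le> sqrt (2 * K * l)"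
    using assms goodD(1)[OF assms(1)] K by (intro mult_left_le) auto
  finally show ?thesis by (simp add: D_0 goodD(1)[OF assms(1)])
qed

text \<open>From 0 to 1/2 the function \<open>w l\<close> gains at most about \<open>A\<close>,
  while \<open>a / 2 = A + \<delta>\<close>; half of \<open>\<delta>\<close> pays for the
  error.\<close>

lemma u_half_le:
  assumes "good l"
  shows "u l (1/2) \<le> - \<delta> / 2"
proof -
  note l = goodD(1)[OF assms]
  have "w l (1/2) - w l 0 \<le> W l (1/2) - W l 0"
    using abs_w_increment[OF l, of 0 "1/2"] by simp
  also have "\<dots> \<le> A + sqrt (2 * K * l)"
    using abs_D_le_soft[OF assms, of "1/2"] by (simp add: D_def W_0[OF l] W\<^sub>Q_half)
  finally have "u l (1/2) \<le> A - a / 2 + sqrt (2 * K * l)"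
    using u_at_0_le[OF l] by (simp add: w_def)
  then show ?thesis
    using goodD(4)[OF assms] \<delta> by simp
qed

text \<open>Either \<open>Q x\<close> exceeds \<open>sqrt (2 * K * l)\<close> and outweighs the
  discount term, or \<open>x\<close> is so close to 1/2 that \<open>u l x\<close> is still
  negative.\<close>

lemma G_pos_middle:
  assumes "good l" "1/4 \<le> x" "x \<le> 3/4"
  shows "0 < G l x"
proof -
  note l = goodD(1)[OF assms(1)]
  have x: "\<bar>x - 1/2\<bar> \<le> 1/4" using assms unfolding abs_le_iff by linarith
  show ?thesis
  proof (cases "c * \<bar>x - 1/2\<bar> > sqrt (2 * K * l)")
    case True
    with Q_growth_half[OF x] have "sqrt (2 * K * l) < Q x" by linarith
    then have "(sqrt (2 * K * l))\<^sup>2 < (Q x)\<^sup>2"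
      using K l by (intro power_strict_mono) auto
    moreover have "2 * l * u l x \<le> 2 * l * K"
      using l goodD(3)[OF assms(1), of x] by (intro mult_left_mono) auto
    moreover have "(sqrt (2 * K * l))\<^sup>2 = 2 * l * K"
      using K l by simp
    ultimately show ?thesis unfolding G_def by linarith
  next
    case False
    then have "\<bar>x - 1/2\<bar> \<le> sqrt (2 * K * l) / c"
      using c by (simp add: field_simps)
    then have "K * \<bar>x - 1/2\<bar> \<le> K * (sqrt (2 * K * l) / c)"
      using K by (intro mult_left_mono) auto
    also have "\<dots> = K * sqrt (2 * K * l) / c" by simp
    finally have "K * \<bar>x - 1/2\<bar> \<le> K * sqrt (2 * K * l) / c" .
    with u_lipschitz[OF l, of x "1/2"] goodD(5)[OF assms(1)] u_half_le[OF assms(1)] \<delta>(1)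
    have "u l x < 0" by linarith
    with l have "2 * l * u l x < 0" by (simp add: mult_pos_neg)
    then show ?thesis using zero_le_power2[of "Q x"] unfolding G_def by linarith
  qed
qed

section \<open>The neighbourhood of 0 and the size of \<open>u l 0\<close>\<close>

lemma G_lower_near_0:
  assumes "l > 0" "\<bar>x\<bar> \<le> 1/4"
  shows "c\<^sup>2 * x\<^sup>2 - 2 * l * (u l 0 + K * \<bar>x\<bar>) \<le> G l x"
proof -
  have "(c * \<bar>x\<bar>)\<^sup>2 \<le> (Q x)\<^sup>2"
    using Q_growth_0[OF assms(2)] c by (intro power_mono) auto
  moreover have "2 * l * u l x \<le> 2 * l * (u l 0 + K * \<bar>x\<bar>)"
    using u_lipschitz[OF assms(1), of x 0] assms(1) by (intro mult_left_mono) auto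
  ultimately show ?thesis by (simp add: G_def power_mult_distrib)
qed

text \<open>As \<open>u l 0 \<le> 0\<close>, only the linear term
  \<open>2 * l * K * \<bar>x\<bar>\<close> competes with \<open>c\<^sup>2 * x\<^sup>2\<close>; it
  loses beyond \<open>2 * K * l / c\<^sup>2\<close>, and the threshold is twice that.\<close>

lemma G_pos_near_0:
  assumes "good l" "\<bar>x\<bar> \<le> 1/4" "4 * K / c\<^sup>2 * l \<le> \<bar>x\<bar>"
  shows "0 < G l x"
proof -
  note l = goodD(1)[OF assms(1)]
  have x: "\<bar>x\<bar> > 0"
    using assms(3) K c l by (smt (verit) divide_pos_pos mult_pos_pos zero_less_power)
  have "4 * K * l \<le> c\<^sup>2 * \<bar>x\<bar>"
    using assms(3) c by (simp add: field_simps)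
  then have "4 * K * l * \<bar>x\<bar> \<le> c\<^sup>2 * \<bar>x\<bar> * \<bar>x\<bar>"
    by (rule mult_right_mono) simp
  moreover have "0 < K * l * \<bar>x\<bar>" using K l x by simp
  moreover have "2 * l * (u l 0 + K * \<bar>x\<bar>) \<le> 2 * l * (K * \<bar>x\<bar>)"
    using u_at_0_le[OF l] l by (intro mult_left_mono) auto
  ultimately show ?thesis
    using G_lower_near_0[OF l assms(2)] by (simp add: power2_eq_square mult_ac)
qed

lemma G_pos_inside:
  assumes "good l" "4 * K / c\<^sup>2 * l \<le> x" "x \<le> 1 - 4 * K / c\<^sup>2 * l"
  shows "0 < G l x"
proof -
  note l = goodD(1)[OF assms(1)]
  have "0 < 4 * K / c\<^sup>2 * l" using K c l by simp
  with assms have x01: "0 < x" "x < 1" by linarith+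
  consider "x \<le> 1/4" | "1/4 \<le> x" "x \<le> 3/4" | "3/4 \<le> x" by linarith
  then show ?thesis
  proof cases
    case 1
    then show ?thesis using G_pos_near_0[of l x] assms x01 by simp
  next
    case 2
    then show ?thesis using G_pos_middle assms by blast
  next
    case 3
    then have "0 < G l (x - 1)"
      using G_pos_near_0[of l "x - 1"] assms x01 by simp
    then show ?thesis using G_period[OF l, of "x - 1"] by simp
  qed
qed

lemma G_pos_if_u_at_0_small:
  assumes "good l" and small: "u l 0 < - (K\<^sup>2 / c\<^sup>2) * l"
  shows "0 < G l x"
proof -
  note l = goodD(1)[OF assms(1)]
  have near_0: "0 < G l y" if y: "\<bar>y\<bar> \<le> 1/4" for y
  proof -
    have "2 * (l * K * \<bar>y\<bar>) \<le> c\<^sup>2 * y\<^sup>2 + l\<^sup>2 * K\<^sup>2 / c\<^sup>2"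
    proof -
      \<comment> \<open>Completing the square: the linear term exceeds the quadratic one by at most
        \<open>l\<^sup>2 * K\<^sup>2 / c\<^sup>2\<close>, which the assumed negativity of
        \<open>u l 0\<close> compensates.\<close>
      have "0 \<le> (c * \<bar>y\<bar> - l * K / c)\<^sup>2" by simp
      also have "\<dots> = c\<^sup>2 * y\<^sup>2 + l\<^sup>2 * K\<^sup>2 / c\<^sup>2 - 2 * (l * K * \<bar>y\<bar>)"
        using c by (simp add: power2_diff power_mult_distrib power_divide)
      finally show ?thesis by simp
    qed
    moreover have "2 * l * u l 0 < 2 * l * (- (K\<^sup>2 / c\<^sup>2) * l)"
      using small l by (intro mult_strict_left_mono) auto
    moreover have "0 \<le> l\<^sup>2 * K\<^sup>2 / c\<^sup>2" by simp
    ultimately show ?thesis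
      using G_lower_near_0[OF l y] by (simp add: power2_eq_square algebra_simps)
  qed
  have "periodic_fun_simple' (G l)" by standard (rule G_period[OF l])
  then have "G l (frac x) = G l x" by (rule periodic_frac)
  moreover have "0 < G l (frac x)"
  proof -
    have fx: "0 \<le> frac x" "frac x < 1" using frac_lt_1[of x] by auto
    consider "frac x \<le> 1/4" | "1/4 \<le> frac x" "frac x \<le> 3/4" | "3/4 \<le> frac x" by linarith
    then show ?thesis
    proof cases
      case 1
      with fx near_0[of "frac x"] show ?thesis by simp
    next
      case 2
      with G_pos_middle[OF assms(1)] show ?thesis by blast
    next
      case 3
      with fx near_0[of "frac x - 1"] have "0 < G l (frac x - 1)" by simp
      with G_period[OF l, of "frac x - 1"] show ?thesis by simp
    qed
  qed
  ultimately show ?thesis by simp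
qed

lemma w_shift_nat: "l > 0 \<Longrightarrow> w l (real n) = w l 0 + real n * a"
  by (induction n) (simp_all add: w_period[of l "real n" for n, simplified add.commute] algebra_simps)

text \<open>Otherwise \<open>G l > 0\<close> everywhere, so \<open>w l\<close> has no valley on the
  line. As it rises by \<open>a\<close> per period it must increase, and it then gains
  \<open>W l 1\<close>, which is close to \<open>A + B\<close> and exceeds \<open>a\<close>.\<close>

lemma u_at_0_ge:
  assumes "good l"
  shows "- (K\<^sup>2 / c\<^sup>2) * l \<le> u l 0"
proof (rule ccontr)
  assume "\<not> - (K\<^sup>2 / c\<^sup>2) * l \<le> u l 0"
  then have pos: "0 < G l x" for x
    using G_pos_if_u_at_0_small[OF assms] by simp
  note l = goodD(1)[OF assms]
  have "mono_on {0..1} (w l)"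
  proof (rule mono_onI)
    fix s t :: real
    assume st: "s \<in> {0..1}" "t \<in> {0..1}" "s \<le> t"
    \<comment> \<open>An integer beyond \<open>t\<close> at which \<open>w l\<close> is at least
      \<open>w l s\<close>; quasiconcavity between \<open>s\<close> and this integer then yields
      \<open>w l s \<le> w l t\<close>.\<close>
    obtain n :: nat where n: "(w l s - w l 0) / a + 1 < real n"
      using reals_Archimedean2 by blast
    obtain m :: nat where m: "t < real m" using reals_Archimedean2 by blast
    define k where "k = max n m"
    have "(w l s - w l 0) / a \<le> real k" using n by (simp add: k_def)
    then have "w l s \<le> w l (real k)"
      using a_pos by (simp add: w_shift_nat[OF l] field_simps)
    moreover have "min (w l s) (w l (real k)) \<le> w l t"
      by (rule eikonal_super_quasiconcave[OF eikonal_super_w[OF l] continuous_on_w[OF l] pos])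
         (use st m in \<open>simp_all add: k_def\<close>)
    ultimately show "w l s \<le> w l t" by simp
  qed
  then have "W l 1 - W l 0 \<le> w l 1 - w l 0"
    by (intro eikonal_super_increment[where g="g l"])
       (simp_all add: l g_square g_pos_iff pos eikonal_super_w continuous_on_w continuous_on_g DERIV_W)
  moreover have "w l 1 = w l 0 + a" using w_period[OF l, of 0] by simp
  ultimately have "W l 1 \<le> a" by (simp add: W_0[OF l])
  with abs_D_le_soft[OF assms, of 1] goodD(4)[OF assms] \<delta> show False
    by (simp add: D_def W\<^sub>Q_1 abs_le_iff)
qed

lemma W_lipschitz:
  assumes "l > 0"
  shows "\<bar>W l x - W l y\<bar> \<le> K * \<bar>x - y\<bar>"
proof -
  have "\<bar>W l y - W l x\<bar> \<le> K * (y - x)" if "x \<le> y" for x y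
    using abs_increment_le_linear[OF that DERIV_W[OF assms], of K] g_nonneg[OF assms] g_le[OF assms]
    by simp
  from this[of x y] this[of y x] show ?thesis
    by (cases "x \<le> y") (simp_all add: abs_minus_commute)
qed

lemma w_approx_W:
  obtains C where "C > 0" "\<And>l x. good l \<Longrightarrow> 0 \<le> x \<Longrightarrow> x \<le> 1 \<Longrightarrow>
    \<bar>w l x - min (W l x) (a + W l 1 - W l x)\<bar> \<le> C * l"
proof (rule that)
  define r where "r = 4 * K / c\<^sup>2"
  have r: "r > 0" using K c by (simp add: r_def)
  show "K\<^sup>2 / c\<^sup>2 + 4 * K * r > 0" using K c r by (simp add: add_pos_pos)
  fix l x assume good: "good l" and x: "0 \<le> x" "x \<le> (1::real)"
  note l = goodD(1)[OF good]
  define p where "p = r * l"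
  define q where "q = 1 - r * l"
  \<comment> \<open>The minimum formula is available on \<open>[p, q]\<close> only, so
    \<open>x\<close> is clamped to it. Replacing \<open>p\<close>, \<open>q\<close> and
    \<open>x'\<close> by 0, 1 and \<open>x\<close> costs at most \<open>3 * e\<close> in each branch
    and one more \<open>e\<close> on the left-hand side.\<close>
  define x' where "x' = max p (min q x)"
  define e where "e = K * (r * l)"
  have pq: "0 < p" "p < q" "q < 1"
    using mult_pos_pos[OF r l] goodD(6)[OF good] unfolding p_def q_def r_def by linarith+
  have x': "p \<le> x'" "x' \<le> q" using pq by (auto simp: x'_def)
  have dist: "\<bar>x - x'\<bar> \<le> r * l" "\<bar>p - 0\<bar> \<le> r * l" "\<bar>q - 1\<bar> \<le> r * l"
    using x pq by (auto simp: x'_def p_def q_def)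
  note bound = mult_left_mono[OF dist(1), of K] mult_left_mono[OF dist(2), of K]
    mult_left_mono[OF dist(3), of K]
  have K0: "0 \<le> K" using K by simp
  have w: "\<bar>w l x - w l x'\<bar> \<le> e" "\<bar>w l p - w l 0\<bar> \<le> e" "\<bar>w l q - w l 1\<bar> \<le> e"
    using w_lipschitz[OF l, of x x'] w_lipschitz[OF l, of p 0] w_lipschitz[OF l, of q 1] bound[OF K0]
    unfolding e_def by linarith+
  have W: "\<bar>W l x - W l x'\<bar> \<le> e" "\<bar>W l p - W l 0\<bar> \<le> e" "\<bar>W l q - W l 1\<bar> \<le> e"
    using W_lipschitz[OF l, of x x'] W_lipschitz[OF l, of p 0] W_lipschitz[OF l, of q 1] bound[OF K0]
    unfolding e_def by linarith+
  have w01: "w l 1 = w l 0 + a" "w l 0 = u l 0" "W l 0 = 0"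
    using w_period[OF l, of 0] W_0[OF l] by (simp_all add: w_def)
  have u0: "\<bar>u l 0\<bar> \<le> K\<^sup>2 / c\<^sup>2 * l"
    using u_at_0_le[OF l] u_at_0_ge[OF good] by simp
  have "w l x' = min (w l p + (W l x' - W l p)) (w l q + (W l q - W l x'))"
    by (rule w_min_formula[OF l x'], rule G_pos_inside[OF good]) (simp_all add: p_def q_def r_def)
  moreover have "\<bar>w l p + (W l x' - W l p) - W l x\<bar> \<le> K\<^sup>2 / c\<^sup>2 * l + 3 * e"
    "\<bar>w l q + (W l q - W l x') - (a + W l 1 - W l x)\<bar> \<le> K\<^sup>2 / c\<^sup>2 * l + 3 * e"
    using w(2,3) W w01 u0 by linarith+
  then have "\<bar>min (w l p + (W l x' - W l p)) (w l q + (W l q - W l x'))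
      - min (W l x) (a + W l 1 - W l x)\<bar> \<le> K\<^sup>2 / c\<^sup>2 * l + 3 * e"
    by (simp add: min_def abs_le_iff)
  ultimately have "\<bar>w l x - min (W l x) (a + W l 1 - W l x)\<bar> \<le> K\<^sup>2 / c\<^sup>2 * l + 4 * e"
    using w(1) by linarith
  then show "\<bar>w l x - min (W l x) (a + W l 1 - W l x)\<bar> \<le> (K\<^sup>2 / c\<^sup>2 + 4 * K * r) * l"
    by (simp add: e_def algebra_simps)
qed

section \<open>The rate of convergence\<close>

text \<open>Two bounds are added: multiplied by \<open>s\<close>, the difference is controlled by
  \<open>g l x + Q x \<ge> c * s\<close>; multiplied by \<open>sqrt l\<close>, by the uniform square
  root bound.\<close>

lemma abs_g_diff_le_inverse:
  assumes "good l" and s: "0 \<le> s" "c * s \<le> Q x"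
  shows "\<bar>g l x - Q x\<bar> \<le> (2 * K / c + sqrt (2 * K)) * l / (s + sqrt l)"
proof -
  note l = goodD(1)[OF assms(1)]
  have "\<bar>g l x - Q x\<bar> * (c * s) \<le> \<bar>g l x - Q x\<bar> * (g l x + Q x)"
    using s g_nonneg[OF l, of x] by (intro mult_left_mono) auto
  also have "\<dots> \<le> 2 * K * l" by (rule abs_g_diff_times_sum[OF assms(1)])
  finally have "\<bar>g l x - Q x\<bar> * s \<le> 2 * K / c * l"
    using c by (simp add: field_simps)
  moreover have "\<bar>g l x - Q x\<bar> * sqrt l \<le> sqrt (2 * K * l) * sqrt l"
    using abs_g_diff_le[OF assms(1)] l by (intro mult_right_mono) auto
  moreover have "sqrt (2 * K * l) * sqrt l = sqrt (2 * K) * (sqrt l * sqrt l)"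
    by (simp only: real_sqrt_mult mult.assoc)
  ultimately have "\<bar>g l x - Q x\<bar> * (s + sqrt l) \<le> (2 * K / c + sqrt (2 * K)) * l"
    using l by (simp add: distrib_left distrib_right)
  moreover have "0 < s + sqrt l" using s l by (simp add: add_nonneg_pos)
  ultimately show ?thesis by (simp add: pos_le_divide_eq)
qed

text \<open>Each quarter of the period has one zero of \<open>V\<close> at an end and contributes at
  most \<open>m * (- ln (sqrt l)) = m * \<bar>ln l\<bar> / 2\<close>; there are four
  quarters.\<close>

lemma abs_D_le_log:
  assumes "good l" "0 \<le> x" "x \<le> 1"
  shows "\<bar>D l x\<bar> \<le> 2 * (2 * K / c + sqrt (2 * K)) * (l * \<bar>ln l\<bar>)"
proof -
  note l = goodD(1,2)[OF assms(1)]
  define m where "m = (2 * K / c + sqrt (2 * K)) * l"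
  define e where "e = sqrt l"
  have m: "0 \<le> m" using K c l by (simp add: m_def)
  have "sqrt l \<le> sqrt ((3/4)\<^sup>2)"
    using l by (intro real_sqrt_le_mono) (simp add: power2_eq_square)
  then have e: "0 < e" "e \<le> 3/4" using l by (simp_all add: e_def)
  have ln_diff: "m * (ln (s + e) - ln (t + e)) \<le> m * (- ln e)" if "0 \<le> t" "t \<le> s" "s \<le> 1/4" for s t
  proof (rule mult_left_mono[OF _ m])
    have "ln (s + e) \<le> 0" "ln e \<le> ln (t + e)" using that e by auto
    then show "ln (s + e) - ln (t + e) \<le> - ln e" by simp
  qed
  have right: "\<bar>D l y - D l p\<bar> \<le> m * (- ln e)"
    if p: "\<And>t. \<bar>t - p\<bar> \<le> 1/4 \<Longrightarrow> c * \<bar>t - p\<bar> \<le> Q t" and y: "p \<le> y" "y \<le> p + 1/4" for p y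
  proof -
    have "\<bar>D l y - D l p\<bar> \<le> m * (ln (y - p + e) - ln (p - p + e))"
    proof (rule abs_increment_le_log_right[OF y(1) _ e(1) DERIV_D[OF l(1)]])
      fix t assume t: "p \<le> t" "t \<le> y"
      then have "c * (t - p) \<le> Q t"
        using p[of t] y by simp
      then show "\<bar>g l t - Q t\<bar> \<le> m / (t - p + e)"
        unfolding m_def e_def using abs_g_diff_le_inverse[OF assms(1)] t by simp
    qed simp
    also have "\<dots> \<le> m * (- ln e)" using y by (intro ln_diff) auto
    finally show ?thesis .
  qed
  have left: "\<bar>D l y - D l x\<bar> \<le> m * (- ln e)"
    if p: "\<And>t. \<bar>t - p\<bar> \<le> 1/4 \<Longrightarrow> c * \<bar>t - p\<bar> \<le> Q t" and y: "x \<le> y" "p - 1/4 \<le> x" "y \<le> p" for p x y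
  proof -
    have "\<bar>D l y - D l x\<bar> \<le> m * (ln (p - x + e) - ln (p - y + e))"
    proof (rule abs_increment_le_log_left[OF y(1,3) e(1) DERIV_D[OF l(1)]])
      fix t assume t: "x \<le> t" "t \<le> y"
      then have "c * (p - t) \<le> Q t"
        using p[of t] y by simp
      then show "\<bar>g l t - Q t\<bar> \<le> m / (p - t + e)"
        unfolding m_def e_def using abs_g_diff_le_inverse[OF assms(1)] t y by simp
    qed
    also have "\<dots> \<le> m * (- ln e)" using y by (intro ln_diff) auto
    finally show ?thesis .
  qed
  have Q_growth_1: "c * \<bar>t - 1\<bar> \<le> Q t" if "\<bar>t - 1\<bar> \<le> 1/4" for t
    using Q_growth_0[OF that] Q_period[of "t - 1"] by simp
  note right_0 = right[of 0, simplified, OF Q_growth_0]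
  note right_half = right[OF Q_growth_half]
  note left_half = left[OF Q_growth_half]
  note left_1 = left[OF Q_growth_1]
  have E: "0 \<le> m * (- ln e)" using m e by (intro mult_nonneg_nonneg) auto
  have D0: "D l 0 = 0" by (rule D_0[OF l(1)])
  have D1: "\<bar>D l (1/4)\<bar> \<le> m * (- ln e)" using right_0[of "1/4"] D0 by simp
  have D2: "\<bar>D l (1/2) - D l (1/4)\<bar> \<le> m * (- ln e)" using left_half[of "1/4" "1/2"] by simp
  have D3: "\<bar>D l (3/4) - D l (1/2)\<bar> \<le> m * (- ln e)" using right_half[of "3/4"] by simp
  consider "x \<le> 1/4" | "1/4 \<le> x" "x \<le> 1/2" | "1/2 \<le> x" "x \<le> 3/4" | "3/4 \<le> x" by linarith
  then have "\<bar>D l x\<bar> \<le> 4 * (m * (- ln e))"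
  proof cases
    case 1
    have "\<bar>D l x\<bar> \<le> m * (- ln e)" using right_0[of x] 1 D0 assms by simp
    with E show ?thesis by linarith
  next
    case 2
    have "\<bar>D l x - D l (1/4)\<bar> \<le> m * (- ln e)" using left_half[of "1/4" x] 2 by simp
    with D1 E show ?thesis by linarith
  next
    case 3
    have "\<bar>D l x - D l (1/2)\<bar> \<le> m * (- ln e)" using right_half[of x] 3 by simp
    with D1 D2 E show ?thesis by linarith
  next
    case 4
    have "\<bar>D l x - D l (3/4)\<bar> \<le> m * (- ln e)" using left_1[of "3/4" x] 4 assms by simp
    with D1 D2 D3 E show ?thesis by linarith
  qed
  moreover have "- ln e = \<bar>ln l\<bar> / 2"
    using l by (simp add: e_def ln_sqrt)
  ultimately have "\<bar>D l x\<bar> \<le> 4 * (m * (\<bar>ln l\<bar> / 2))" by (simp only:)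
  then show ?thesis by (simp add: m_def algebra_simps)
qed

section \<open>The limit function and the upper bound\<close>

definition w\<^sub>0 :: "real \<Rightarrow> real" where "w\<^sub>0 x = min (W\<^sub>Q x) (a + W\<^sub>Q 1 - W\<^sub>Q x)"

lemma w_approx_w\<^sub>0:
  obtains C where "C > 0" "\<forall>\<^sub>F l in at_right 0. \<forall>x\<in>{0..1}. \<bar>w l x - w\<^sub>0 x\<bar> \<le> C * (l * \<bar>ln l\<bar>)"
proof -
  obtain C where C: "C > 0" "\<And>l x. good l \<Longrightarrow> 0 \<le> x \<Longrightarrow> x \<le> 1 \<Longrightarrow>
      \<bar>w l x - min (W l x) (a + W l 1 - W l x)\<bar> \<le> C * l"
    using w_approx_W by blast
  define m where "m = 2 * (2 * K / c + sqrt (2 * K))"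
  have m: "m > 0" using K c by (simp add: m_def add_pos_pos)
  have "\<forall>\<^sub>F l in at_right 0. \<forall>x\<in>{0..1}. \<bar>w l x - w\<^sub>0 x\<bar> \<le> (C + 2 * m) * (l * \<bar>ln l\<bar>)"
    using eventually_good eventually_abs_ln_ge[of 1]
  proof eventually_elim
    case (elim l)
    note l = goodD(1)[OF elim(1)]
    show ?case
    proof
      fix x :: real assume x: "x \<in> {0..1}"
      have D: "\<bar>D l x\<bar> \<le> m * (l * \<bar>ln l\<bar>)" "\<bar>D l 1\<bar> \<le> m * (l * \<bar>ln l\<bar>)"
        using abs_D_le_log[OF elim(1)] x by (auto simp: m_def)
      have "C * l \<le> C * (l * \<bar>ln l\<bar>)"
        using C l elim(2) by simp
      moreover have "\<bar>w l x - min (W l x) (a + W l 1 - W l x)\<bar> \<le> C * l"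
        using C(2)[OF elim(1)] x by simp
      \<comment> \<open>The entries of the two minima differ by \<open>D l x\<close> and
        \<open>D l 1 - D l x\<close>, and a minimum changes by no more than its entries do.\<close>
      moreover have "\<bar>min (W l x) (a + W l 1 - W l x) - w\<^sub>0 x\<bar> \<le> \<bar>D l x\<bar> + \<bar>D l 1\<bar>"
        unfolding w\<^sub>0_def D_def by linarith
      ultimately have "\<bar>w l x - w\<^sub>0 x\<bar> \<le> C * (l * \<bar>ln l\<bar>) + m * (l * \<bar>ln l\<bar>) + m * (l * \<bar>ln l\<bar>)"
        using D by linarith
      then show "\<bar>w l x - w\<^sub>0 x\<bar> \<le> (C + 2 * m) * (l * \<bar>ln l\<bar>)"
        by (simp add: algebra_simps)
    qed
  qed
  with C m that[of "C + 2 * m"] show thesis by simp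
qed

text \<open>The error \<open>l * \<bar>ln l\<bar>\<close> tends to 0, so the approximation by
  \<open>w\<^sub>0\<close> identifies the pointwise limit.\<close>

lemma u\<^sub>0_eq:
  assumes "x \<in> {0..1}"
  shows "u\<^sub>0 x = w\<^sub>0 x - a * x"
proof -
  obtain C where C: "\<forall>\<^sub>F l in at_right 0. \<forall>x\<in>{0..1}. \<bar>w l x - w\<^sub>0 x\<bar> \<le> C * (l * \<bar>ln l\<bar>)"
    using w_approx_w\<^sub>0 by blast
  have "((\<lambda>l. C * (l * \<bar>ln l\<bar>)) \<longlongrightarrow> C * 0) (at_right 0)"
    by (rule tendsto_mult_left[OF tendsto_mult_abs_ln_at_right_0])
  then have lim: "((\<lambda>l. C * (l * \<bar>ln l\<bar>)) \<longlongrightarrow> 0) (at_right 0)" by simp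
  have "\<forall>\<^sub>F l in at_right 0. norm (w l x - w\<^sub>0 x) \<le> C * (l * \<bar>ln l\<bar>)"
    using C by eventually_elim (use assms in simp)
  then have "((\<lambda>l. w l x - w\<^sub>0 x) \<longlongrightarrow> 0) (at_right 0)"
    using lim by (rule Lim_null_comparison)
  then have "((\<lambda>l. (w l x - w\<^sub>0 x) + (w\<^sub>0 x - a * x)) \<longlongrightarrow> 0 + (w\<^sub>0 x - a * x)) (at_right 0)"
    by (rule tendsto_add[OF _ tendsto_const])
  then have "((\<lambda>l. u l x) \<longlongrightarrow> w\<^sub>0 x - a * x) (at_right 0)"
    by (simp add: w_def)
  then show ?thesis
    by (rule tendsto_unique[OF trivial_limit_at_right_real u\<^sub>0_limit])
qed

lemma u\<^sub>0_period: "u\<^sub>0 (x + 1) = u\<^sub>0 x"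
proof -
  have "\<forall>\<^sub>F l::real in at_right 0. 0 < l" by (rule eventually_at_right_less)
  then have "\<forall>\<^sub>F l in at_right 0. u l (x + 1) = u l x"
    by eventually_elim (rule u_period)
  with u\<^sub>0_limit[of "x + 1"] have "((\<lambda>l. u l x) \<longlongrightarrow> u\<^sub>0 (x + 1)) (at_right 0)"
    by (rule Lim_transform_eventually)
  then show ?thesis
    by (rule tendsto_unique[OF trivial_limit_at_right_real _ u\<^sub>0_limit])
qed

lemma u_approx_u\<^sub>0:
  obtains C where "C > 0" "\<forall>\<^sub>F l in at_right 0. \<forall>x. \<bar>u l x - u\<^sub>0 x\<bar> \<le> C * (l * \<bar>ln l\<bar>)"
proof -
  obtain C where C: "C > 0" "\<forall>\<^sub>F l in at_right 0. \<forall>x\<in>{0..1}. \<bar>w l x - w\<^sub>0 x\<bar> \<le> C * (l * \<bar>ln l\<bar>)"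
    using w_approx_w\<^sub>0 by blast
  have per: "periodic_fun_simple' u\<^sub>0" by standard (rule u\<^sub>0_period)
  have "\<forall>\<^sub>F l::real in at_right 0. 0 < l" by (rule eventually_at_right_less)
  with C(2) have "\<forall>\<^sub>F l in at_right 0. \<forall>x. \<bar>u l x - u\<^sub>0 x\<bar> \<le> C * (l * \<bar>ln l\<bar>)"
  proof eventually_elim
    case (elim l)
    show ?case
    proof
      fix x :: real
      have x: "frac x \<in> {0..1}" using frac_lt_1[of x] by simp
      with elim(1) have "\<bar>w l (frac x) - w\<^sub>0 (frac x)\<bar> \<le> C * (l * \<bar>ln l\<bar>)" by blast
      then have "\<bar>u l (frac x) - u\<^sub>0 (frac x)\<bar> \<le> C * (l * \<bar>ln l\<bar>)"
        by (simp add: u\<^sub>0_eq[OF x] w_def algebra_simps)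
      then show "\<bar>u l x - u\<^sub>0 x\<bar> \<le> C * (l * \<bar>ln l\<bar>)"
        by (simp add: periodic_frac[OF per] periodic_frac[OF u_periodic[OF elim(2)]])
    qed
  qed
  with C that show thesis by blast
qed

section \<open>The logarithmic lower bound at 1/2\<close>

lemma Q_diff_le:
  assumes "good l" "0 \<le> s" "k > 0" "k * s \<le> Q x" "u l x \<le> h * s" "s > 0 \<or> Q x = 0"
  shows "- (2 * h / k) * l \<le> g l x - Q x \<or> 0 \<le> g l x - Q x"
proof (rule disjCI)
  note l = goodD(1)[OF assms(1)]
  assume "\<not> 0 \<le> g l x - Q x"
  then have neg: "0 \<le> Q x - g l x" "0 < Q x" using g_nonneg[OF l, of x] by auto
  with assms have s: "s > 0" by auto
  \<comment> \<open>Both the lower bound for \<open>g l + Q\<close> and the upper bound for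
    \<open>u l\<close> are proportional to \<open>s\<close>; the factor cancels and the loss is of
    order \<open>l\<close>.\<close>
  have "(Q x - g l x) * (k * s) \<le> (Q x - g l x) * (g l x + Q x)"
    using neg assms g_nonneg[OF l, of x] by (intro mult_left_mono) auto
  also have "\<dots> = 2 * l * u l x" using g_diff_times_sum[OF l, of x] by (simp add: algebra_simps)
  also have "\<dots> \<le> 2 * l * (h * s)" using assms l by (intro mult_left_mono) auto
  finally have "((Q x - g l x) * k) * s \<le> (2 * l * h) * s" by (simp add: mult_ac)
  then have "(Q x - g l x) * k \<le> 2 * l * h" using s by simp
  then show "- (2 * h / k) * l \<le> g l x - Q x" using assms(3) by (simp add: field_simps)
qed

text \<open>Away from 1/2 the integrand \<open>g l - Q\<close> is at least \<open>- k * l\<close>.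
  Near 1/2 the solution is strictly negative, so the integrand is at least
  \<open>m / (1/2 - x + e)\<close>, whose integral is the logarithm.\<close>

lemma D_half_ge:
  obtains c\<^sub>1 C where "c\<^sub>1 > 0" "\<And>l. good l \<Longrightarrow> c\<^sub>1 * (l * \<bar>ln l\<bar>) - C * l \<le> D l (1/2)"
proof -
  \<comment> \<open>Within distance \<open>r\<close> of 1/2 the bounds on \<open>Q\<close> hold and
    the Lipschitz estimate keeps \<open>u l \<le> - \<delta> / 4\<close>.\<close>
  define r where "r = min (1/4) (\<delta> / (4 * K))"
  \<comment> \<open>Chosen so that \<open>g l + Q \<le> 2 * Q + sqrt (2 * K) * e\<close> is at most
    \<open>M\<close> times the shifted distance to 1/2.\<close>
  define M where "M = 2 * L + sqrt (2 * K)"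
  define k where "k = 2 * K / (c * r)"
  have r: "0 < r" "r \<le> 1/4" "K * r \<le> \<delta> / 4"
    using \<delta>(1) K by (auto simp: r_def min_def field_simps)
  have M: "M > 0" using L K by (simp add: M_def add_pos_pos)
  have k: "k > 0" using K c r by (simp add: k_def)
  have bound: "\<delta> / (4 * M) * (l * \<bar>ln l\<bar>) - (k + \<delta> / (2 * M) * \<bar>ln r\<bar>) * l \<le> D l (1/2)"
    if good: "good l" for l
  proof -
    note l = goodD(1,2)[OF good]
    define e where "e = sqrt l"
    have e: "0 < e" using l by (simp add: e_def)
    define m where "m = l * \<delta> / (2 * M)"
    have m: "m > 0" using l \<delta>(1) M by (simp add: m_def)
    have Q_0: "0 < x \<or> Q x = 0" if "0 \<le> x" for x
      using that V_at_zeros by (cases "x = 0") (simp_all add: Q)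
    have far: "- k * l \<le> g l x - Q x" if x: "0 \<le> x" "x \<le> 1/2 - r" for x
    proof -
      have kl: "0 \<le> k * l" using k l by simp
      show ?thesis
      proof (cases "x \<le> 1/4")
        case True
        \<comment> \<open>The sign of \<open>u l 0\<close> is essential here: the bound
          \<open>u l x \<le> K\<close> alone would allow a loss of order \<open>l / x\<close>, hence
          a competing logarithm.\<close>
        have "u l x \<le> K * x"
          using u_lipschitz[OF l(1), of x 0] u_at_0_le[OF l(1)] x by simp
        then have "- (2 * K / c) * l \<le> g l x - Q x \<or> 0 \<le> g l x - Q x"
          using x True c Q_growth_0[of x] Q_0
          by (intro Q_diff_le[OF good, of x c]) auto
        moreover have "2 * K / c * l \<le> k * l"
          unfolding k_def using K c r l
          by (intro mult_right_mono divide_left_mono) (auto simp: mult_le_cancel_left1)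
        ultimately show ?thesis using kl by (elim disjE) simp_all
      next
        case False
        then have "\<bar>x - 1/2\<bar> \<le> 1/4" "\<bar>x - 1/2\<bar> = 1/2 - x"
          using x r by auto
        with Q_growth_half[of x] have "c * (1/2 - x) \<le> Q x" by simp
        moreover have "c * r \<le> c * (1/2 - x)" using c x by (intro mult_left_mono) auto
        ultimately have "c * r \<le> Q x" by linarith
        \<comment> \<open>Here \<open>Q\<close> is bounded below by the constant
          \<open>c * r\<close>, so \<open>s = 1\<close> and \<open>h = K\<close> suffice.\<close>
        then have "- (2 * K / (c * r)) * l \<le> g l x - Q x \<or> 0 \<le> g l x - Q x"
          using c r goodD(3)[OF good, of x]
          by (intro Q_diff_le[OF good, of 1]) auto
        then show ?thesis using kl by (auto simp: k_def)
      qed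
    qed
    have near: "m / (1/2 - x + e) \<le> g l x - Q x" if x: "1/2 - r \<le> x" "x \<le> 1/2" for x
    proof -
      have "\<bar>x - 1/2\<bar> = 1/2 - x" using x by simp
      with x r Q_le_half[of x] have Qx: "Q x \<le> L * (1/2 - x)" by simp
      have "K * \<bar>x - 1/2\<bar> \<le> K * r" using K x by (intro mult_left_mono) auto
      with u_lipschitz[OF l(1), of x "1/2"] u_half_le[OF good] r have "u l x \<le> - \<delta> / 4" by simp
      then have "2 * l * u l x \<le> 2 * l * (- \<delta> / 4)" using l by (intro mult_left_mono) auto
      then have num: "l * \<delta> / 2 \<le> (g l x - Q x) * (g l x + Q x)"
        using g_diff_times_sum[OF l(1), of x] by simp
      have "g l x \<le> Q x + sqrt (2 * K) * e"
        using abs_g_diff_le[OF good, of x] by (simp add: e_def real_sqrt_mult)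
      moreover have "M * (1/2 - x + e) = 2 * (L * (1/2 - x)) + sqrt (2 * K) * e
          + (sqrt (2 * K) * (1/2 - x) + 2 * L * e)"
        by (simp add: M_def algebra_simps)
      moreover have "0 \<le> sqrt (2 * K) * (1/2 - x) + 2 * L * e" using K L e x by simp
      ultimately have den: "g l x + Q x \<le> M * (1/2 - x + e)" using Qx by linarith
      have "0 < (g l x - Q x) * (g l x + Q x)" using num l \<delta>(1) by (smt (verit) divide_pos_pos mult_pos_pos)
      then have "0 \<le> g l x - Q x"
        using g_nonneg[OF l(1), of x] Q_nonneg[of x] by (simp add: zero_less_mult_iff)
      then have "(g l x - Q x) * (g l x + Q x) \<le> (g l x - Q x) * (M * (1/2 - x + e))"
        using den by (intro mult_left_mono) auto
      with num have "l * \<delta> / 2 \<le> ((g l x - Q x) * (1/2 - x + e)) * M" by (simp add: mult_ac)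
      then have "m \<le> (g l x - Q x) * (1/2 - x + e)"
        using M by (simp add: m_def field_simps)
      moreover have "0 < 1/2 - x + e" using x e by simp
      ultimately show ?thesis by (simp add: pos_divide_le_eq)
    qed
    have "- k * l * (1/2 - r) - - k * l * 0 \<le> D l (1/2 - r) - D l 0"
      by (rule increment_le_increment[OF _ DERIV_cmult_Id DERIV_D[OF l(1)] far]) (use r in auto)
    moreover have "k * l * (1/2 - r) \<le> k * l" using k l r by (intro mult_left_le) auto
    ultimately have D1: "- (k * l) \<le> D l (1/2 - r)" by (simp add: D_0[OF l(1)])
    have "- m * ln (1/2 - 1/2 + e) - - m * ln (1/2 - (1/2 - r) + e) \<le> D l (1/2) - D l (1/2 - r)"
      by (rule increment_le_increment[OF _ DERIV_ln_shift_left[OF e] DERIV_D[OF l(1)] near])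
         (use r in auto)
    then have D2: "m * (ln (r + e) - ln e) \<le> D l (1/2) - D l (1/2 - r)"
      by (simp add: algebra_simps)
    have "ln r \<le> ln (r + e)" using r e by simp
    moreover have "- ln e = \<bar>ln l\<bar> / 2" using l by (simp add: e_def ln_sqrt)
    ultimately have "m * (\<bar>ln l\<bar> / 2 - \<bar>ln r\<bar>) \<le> m * (ln (r + e) - ln e)"
      using m by (intro mult_left_mono) auto
    with D1 D2 have "m * (\<bar>ln l\<bar> / 2 - \<bar>ln r\<bar>) - k * l \<le> D l (1/2)" by linarith
    moreover have "m * (\<bar>ln l\<bar> / 2 - \<bar>ln r\<bar>) =
        \<delta> / (4 * M) * (l * \<bar>ln l\<bar>) - \<delta> / (2 * M) * \<bar>ln r\<bar> * l"
      using M by (simp add: m_def field_simps)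
    ultimately show ?thesis by (simp add: distrib_right)
  qed
  show thesis
    by (rule that[OF _ bound]) (use \<delta>(1) M in simp_all)
qed

text \<open>At 1/2 the branch starting from 0 realises the minimum both for \<open>w l\<close> and
  in the limit, so \<open>u l - u\<^sub>0\<close> agrees with \<open>D l\<close> there up to order
  \<open>l\<close>.\<close>

lemma u_half_diff_ge:
  obtains C where "C > 0" "\<forall>\<^sub>F l in at_right 0. C * (l * \<bar>ln l\<bar>) \<le> u l (1/2) - u\<^sub>0 (1/2)"
proof -
  obtain C where C: "C > 0" "\<And>l x. good l \<Longrightarrow> 0 \<le> x \<Longrightarrow> x \<le> 1 \<Longrightarrow>
      \<bar>w l x - min (W l x) (a + W l 1 - W l x)\<bar> \<le> C * l"
    using w_approx_W by blast
  obtain c\<^sub>1 C' where c1: "c\<^sub>1 > 0" "\<And>l. good l \<Longrightarrow> c\<^sub>1 * (l * \<bar>ln l\<bar>) - C' * l \<le> D l (1/2)"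
    using D_half_ge by blast
  have u0: "u\<^sub>0 (1/2) = A - a / 2"
    using u\<^sub>0_eq[of "1/2"] A_less_B a_pos by (simp add: w\<^sub>0_def W\<^sub>Q_half W\<^sub>Q_1)
  have "\<forall>\<^sub>F l in at_right 0. c\<^sub>1 / 2 * (l * \<bar>ln l\<bar>) \<le> u l (1/2) - u\<^sub>0 (1/2)"
    \<comment> \<open>Beyond this threshold the two errors of order \<open>l\<close> take at most
      half of the logarithmic term.\<close>
    using eventually_good eventually_abs_ln_ge[of "2 * (C + C') / c\<^sub>1"]
  proof eventually_elim
    case (elim l)
    note l = goodD(1)[OF elim(1)]
    have "W l (1/2) \<le> a + W l 1 - W l (1/2)"
      using abs_D_le_soft[OF elim(1), of "1/2"] abs_D_le_soft[OF elim(1), of 1]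
        goodD(4)[OF elim(1)] \<delta> a_pos
      by (simp add: D_def W\<^sub>Q_half W\<^sub>Q_1)
    then have "\<bar>w l (1/2) - W l (1/2)\<bar> \<le> C * l"
      using C(2)[OF elim(1), of "1/2"] by (simp add: min_absorb1)
    then have "D l (1/2) - C * l \<le> u l (1/2) - u\<^sub>0 (1/2)"
      unfolding u0 by (simp add: w_def D_def W\<^sub>Q_half)
    moreover have "C + C' \<le> c\<^sub>1 / 2 * \<bar>ln l\<bar>"
      using elim(2) c1 by (simp add: field_simps)
    then have "(C + C') * l \<le> c\<^sub>1 / 2 * \<bar>ln l\<bar> * l"
      using l by (intro mult_right_mono) auto
    ultimately show ?case
      using c1(2)[OF elim(1)] by (simp add: algebra_simps)
  qed
  with c1 that[of "c\<^sub>1 / 2"] show thesis by simp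
qed

section \<open>Two-sided bounds for the supremum norm\<close>

lemma sup_norm_bounds:
  obtains c\<^sub>1 C where "c\<^sub>1 > 0" "C > 0"
    "\<forall>\<^sub>F l in at_right 0. c\<^sub>1 * (l * \<bar>ln l\<bar>) \<le> sup_norm (\<lambda>x. u l x - u\<^sub>0 x) \<and>
       sup_norm (\<lambda>x. u l x - u\<^sub>0 x) \<le> C * (l * \<bar>ln l\<bar>)"
proof -
  obtain c\<^sub>1 where c1: "c\<^sub>1 > 0" "\<forall>\<^sub>F l in at_right 0. c\<^sub>1 * (l * \<bar>ln l\<bar>) \<le> u l (1/2) - u\<^sub>0 (1/2)"
    using u_half_diff_ge by blast
  obtain C where C: "C > 0" "\<forall>\<^sub>F l in at_right 0. \<forall>x. \<bar>u l x - u\<^sub>0 x\<bar> \<le> C * (l * \<bar>ln l\<bar>)"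
    using u_approx_u\<^sub>0 by blast
  from c1(2) C(2) have "\<forall>\<^sub>F l in at_right 0. c\<^sub>1 * (l * \<bar>ln l\<bar>) \<le> sup_norm (\<lambda>x. u l x - u\<^sub>0 x) \<and>
      sup_norm (\<lambda>x. u l x - u\<^sub>0 x) \<le> C * (l * \<bar>ln l\<bar>)"
  proof eventually_elim
    case (elim l)
    have "\<bar>u l (1/2) - u\<^sub>0 (1/2)\<bar> \<le> sup_norm (\<lambda>x. u l x - u\<^sub>0 x)"
      \<comment> \<open>The uniform upper bound also supplies the boundedness under which a single
        value is below the supremum.\<close>
      unfolding sup_norm_def using elim(2) by (intro cSUP_upper) (auto intro!: bdd_aboveI2)
    moreover have "sup_norm (\<lambda>x. u l x - u\<^sub>0 x) \<le> C * (l * \<bar>ln l\<bar>)"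
      unfolding sup_norm_def using elim(2) by (intro cSUP_least) auto
    ultimately show ?case using elim(1) by linarith
  qed
  with c1 C that show thesis by blast
qed

end

lemma (in discounted_torus) sup_norm_asymptotics:
  obtains c\<^sub>1 C where "c\<^sub>1 > 0" "C > 0"
    "\<forall>\<^sub>F l in at_right 0. c\<^sub>1 * (l * \<bar>ln l\<bar>) \<le> sup_norm (\<lambda>x. u l x - u\<^sub>0 x) \<and>
       sup_norm (\<lambda>x. u l x - u\<^sub>0 x) \<le> C * (l * \<bar>ln l\<bar>)"
proof -
  obtain K where K: "K > 0" "\<And>l x. l > 0 \<Longrightarrow> g l x \<le> K"
    "\<And>l x y. l > 0 \<Longrightarrow> \<bar>u l x - u l y\<bar> \<le> K * \<bar>x - y\<bar>"
    "\<And>l x y. l > 0 \<Longrightarrow> \<bar>w l x - w l y\<bar> \<le> K * \<bar>x - y\<bar>"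
    "\<forall>\<^sub>F l in at_right 0. \<forall>x. \<bar>u l x\<bar> \<le> K"
    by (rule uniform_bounds) (rule that)
  obtain c L where c: "c > 0" "L > 0" "\<And>x. \<bar>x\<bar> \<le> 1/4 \<Longrightarrow> c * \<bar>x\<bar> \<le> Q x"
    "\<And>x. \<bar>x - 1/2\<bar> \<le> 1/4 \<Longrightarrow> c * \<bar>x - 1/2\<bar> \<le> Q x"
    "\<And>x. \<bar>x - 1/2\<bar> \<le> 1/4 \<Longrightarrow> Q x \<le> L * \<bar>x - 1/2\<bar>"
    by (rule Q_growth) (rule that)
  interpret discounted_torus_bounds V Q u\<^sub>0 A B a u K c L
    by unfold_locales (fact K c)+
  show thesis by (rule sup_norm_bounds[OF that])
qed

theorem proposition6p3:
  fixes V Q u\<^sub>0 :: "real \<Rightarrow> real" and A B a :: real and u :: "real \<Rightarrow> real \<Rightarrow> real"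
  assumes V_periodic: "periodic_fun_simple' V"
    and V_smooth: "smooth V"
    and V_nonpos: "\<And>x. V x \<le> 0"
    and V_zeros: "{x \<in> {0..<1}. V x = 0} = {0, 1/2}"
    and V_nondeg_0: "(deriv ^^ 2) V 0 < 0"
    and V_nondeg_half: "(deriv ^^ 2) V (1/2) < 0"
    and Q: "Q = (\<lambda>x. sqrt (- 2 * V x))"
    and A: "A = integral {0..1/2} Q"
    and B: "B = integral {1/2..1} Q"
    and A_less_B: "A < B"
    and a: "a = (3 * A + B) / 2"
    and u_solution:
      "\<And>l. l > 0 \<Longrightarrow> torus_viscosity_solution (\<lambda>x r p. l * r + hamiltonian V a x p) (u l)"
    and u\<^sub>0_limit: "\<And>x. ((\<lambda>l. u l x) \<longlongrightarrow> u\<^sub>0 x) (at_right 0)"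
  shows "(\<exists>C\<^sub>0>0. \<exists>l\<^sub>0>0. \<forall>l. 0 < l \<and> l \<le> l\<^sub>0 \<longrightarrow>
            sup_norm (\<lambda>x. u l x - u\<^sub>0 x) \<ge> C\<^sub>0 * (l * \<bar>ln l\<bar>)) \<and>
         asymp_0 (\<lambda>l. sup_norm (\<lambda>x. u l x - u\<^sub>0 x)) (\<lambda>l. l * \<bar>ln l\<bar>)"
proof -
  interpret discounted_torus V Q u\<^sub>0 A B a u
    by (rule discounted_torus.intro) (fact assms)+
  obtain c\<^sub>1 C where c1: "c\<^sub>1 > 0" and C: "C > 0"
    and ev: "\<forall>\<^sub>F l in at_right 0. c\<^sub>1 * (l * \<bar>ln l\<bar>) \<le> sup_norm (\<lambda>x. u l x - u\<^sub>0 x) \<and>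
      sup_norm (\<lambda>x. u l x - u\<^sub>0 x) \<le> C * (l * \<bar>ln l\<bar>)"
    by (rule sup_norm_asymptotics)
  obtain b where b: "b > 0" "\<And>l. 0 < l \<Longrightarrow> l < b \<Longrightarrow> c\<^sub>1 * (l * \<bar>ln l\<bar>) \<le> sup_norm (\<lambda>x. u l x - u\<^sub>0 x)"
    using ev unfolding eventually_at_right_field by blast
  have lower: "\<exists>C\<^sub>0>0. \<exists>l\<^sub>0>0. \<forall>l. 0 < l \<and> l \<le> l\<^sub>0 \<longrightarrow>
      sup_norm (\<lambda>x. u l x - u\<^sub>0 x) \<ge> C\<^sub>0 * (l * \<bar>ln l\<bar>)"
    \<comment> \<open>Halving \<open>b\<close> turns the condition \<open>l < b\<close> into the
      closed condition \<open>l \<le> l\<^sub>0\<close>.\<close>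
    using c1 b by (intro exI[of _ c\<^sub>1] conjI exI[of _ "b / 2"]) auto
  define k where "k = max 1 (max C (inverse c\<^sub>1))"
  have k: "1 \<le> k" "C \<le> k" "inverse k \<le> c\<^sub>1"
    using c1 by (auto simp: k_def intro!: le_imp_inverse_le[of "inverse c\<^sub>1", simplified])
  have "asymp_0 (\<lambda>l. sup_norm (\<lambda>x. u l x - u\<^sub>0 x)) (\<lambda>l. l * \<bar>ln l\<bar>)"
    unfolding asymp_0_def
  proof (intro exI[of _ k] conjI k(1))
    show "\<forall>\<^sub>F l in at_right 0. inverse k * (l * \<bar>ln l\<bar>) \<le> sup_norm (\<lambda>x. u l x - u\<^sub>0 x) \<and>
        sup_norm (\<lambda>x. u l x - u\<^sub>0 x) \<le> k * (l * \<bar>ln l\<bar>)"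
      using ev eventually_at_right_less[of 0]
    proof eventually_elim
      case (elim l)
      then have "0 \<le> l * \<bar>ln l\<bar>" by simp
      then have "inverse k * (l * \<bar>ln l\<bar>) \<le> c\<^sub>1 * (l * \<bar>ln l\<bar>)" "C * (l * \<bar>ln l\<bar>) \<le> k * (l * \<bar>ln l\<bar>)"
        using k by (auto intro: mult_right_mono)
      with elim(1) show ?case by linarith
    qed
  qed
  with lower show ?thesis by blast
qed

end
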